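(* There exists a universal constant $c>0$ such that the following holds. Let $\mathcal{K}\subset\mathbb{R}^n$ be a convex body of diameter at most $1$. Let $f:\mathcal{K}\to[0,+\infty)$ be convex and $1$-Lipschitz, and let $\varepsilon>0$. Then there exists a probability measure $\mu$ on $\mathcal{K}$ such that for every $\alpha\in\mathcal{K}$ and for every convex and $1$-Lipschitz function $g:\mathcal{K}\to\mathbb{R}$ satisfying $g(\alpha)<-\varepsilon$, one has $$\mu\left(\left\{x\in\mathcal{K}:\ |f(x)-g(x)|>\frac{c}{n^{7.5}\log(1+n/\varepsilon)}\max(\varepsilon,f(x))\right\}\right)>\frac{c}{n^{3}\log(1+n/\varepsilon)}.$$
   Context: A convex body is a compact convex set with nonempty interior. Lipschitz constants and diameters are with respect to the Euclidean norm. The constant $c$ is universal: it does not depend on $n,\mathcal{K},f,\varepsilon,\alpha,g$. The measure $\mu$ may depend on $\mathcal{K},f,\varepsilon$ but not on $\alpha$ or $g$.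
   Formalization: The formal theorem assumes n ≥ 1 and ε ≤ n: for all ε > 0 the claim is false, since log(1+n/ε) tends to 0 as ε grows and the lower bound on the probability exceeds 1 (e.g. n = 1, K = [0,1], f = 0, ε = 1/c, g = −ε−1). *)

theory Defs
  imports "HOL-Probability.Probability" "HOL-Library.Function_Algebras"
begin

(* The constant in the theorem is uniform in the dimension, so the dimension has to be a
   bound natural number and cannot be a type such as CARD('n).  R^n is therefore modelled by the
   points of Euclidean_space n, i.e. the sequences nat => real vanishing at all indices >= n.
   On this set the product topology of nat => real is the usual one, but the library metric
   dist on nat => real is NOT the Euclidean one; euclid_dist is used instead.

   The bound eps <= n in the theorem is needed: as eps grows, ln (1 + n / eps) tends to 0, and the
   asserted lower bound on a probability would exceed 1 (e.g. n = 1, K = [0,1], f = 0, eps = 1/c,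
   g = -eps - 1). *)

instantiation "fun" :: (type, real_vector) real_vector
begin

definition scaleR_fun_def: "r *\<^sub>R f = (\<lambda>i. r *\<^sub>R f i)"

instance
  by standard (auto simp: scaleR_fun_def fun_eq_iff scaleR_add_right scaleR_add_left)

end

definition euclid_dist :: "nat \<Rightarrow> (nat \<Rightarrow> real) \<Rightarrow> (nat \<Rightarrow> real) \<Rightarrow> real" where
  "euclid_dist n x y = L2_set (\<lambda>i. x i - y i) {..<n}"

definition euclid_diameter :: "nat \<Rightarrow> (nat \<Rightarrow> real) set \<Rightarrow> real" where
  "euclid_diameter n S = (if S = {} then 0 else SUP (x, y)\<in>S \<times> S. euclid_dist n x y)"

definition euclid_lipschitz_on ::
  "nat \<Rightarrow> real \<Rightarrow> (nat \<Rightarrow> real) set \<Rightarrow> ((nat \<Rightarrow> real) \<Rightarrow> real) \<Rightarrow> bool" where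
  "euclid_lipschitz_on n L S f \<longleftrightarrow>
     0 \<le> L \<and> (\<forall>x\<in>S. \<forall>y\<in>S. \<bar>f x - f y\<bar> \<le> L * euclid_dist n x y)"

definition convex_body :: "nat \<Rightarrow> (nat \<Rightarrow> real) set \<Rightarrow> bool" where
  "convex_body n K \<longleftrightarrow>
     compactin (Euclidean_space n) K \<and> convex K \<and> Euclidean_space n interior_of K \<noteq> {}"

(* The Borel sigma-algebra of K: borel on nat => real is generated by the product topology. *)
definition prob_measure_on :: "(nat \<Rightarrow> real) set \<Rightarrow> (nat \<Rightarrow> real) measure \<Rightarrow> bool" where
  "prob_measure_on K \<mu> \<longleftrightarrow> prob_space \<mu> \<and> sets \<mu> = sets (restrict_space borel K)"

end

(*
  By multiplicative weights and a finite net of Lipschitz functions, it is enough to treat the dual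
  problem: given finitely many weighted pairs (alpha_i, g_i), find one point x at which a fraction
  of order 1 / (n^3 L) of the weight is detected, where L = ln (1 + n / eps).

  Replace alpha_i by the small copy S_i = (1 - tau) alpha_i + tau K with tau = eps / 8, on which g_i
  stays below -eps/2.  Choose an ellipsoid E that almost maximizes the weight of {i. S_i <= E} minus
  a multiple (of order 1 / (n L)) of the log-volume of E.  Cutting E by a halfspace through a point
  near its centre reduces the log-volume by a multiple of 1/n, so near-optimality forces every
  halfspace at distance at most 1 / (8 n) from the centre to meet S_i, inside E, for a fraction of
  order 1 / (n^2 L) of the weight.  The S_i contain a scaled copy of a large simplex of K, which
  bounds the volume of E from below.

  In coordinates in which E is the unit ball, let X maximize ln (f + eps) - a |y|^2 over a small
  ball.  Near X, the function f exceeds the affine function l with l X = f X and gradient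
  2 a (f X + eps) X by at most a controlled quadratic amount.  On the halfspace in direction X,
  where many S_i have a point b with g_i b < -eps/2, the function l is large.  If f and g_i were
  close at X and at the 2n points X + eta e_j, X - eta e_j, then g_i would have at least almost the
  slope of l along the line through X towards b, so by convexity g_i b would be almost l b.  So each
  of these i is detected at one of 2n + 1 points, and one of these points works.
*)

theory Submission
  imports Defs "Jordan_Normal_Form.Determinant"
begin

section \<open>Determinants of square arrays\<close>

hide_const (open) Determinants.det
no_notation vec_nth (infixl "$" 90)

text \<open>Row \<open>V i\<close> is the i-th vector of a system, so \<open>V(k := x)\<close>
  exchanges one vector. Only entries with both indices below \<open>n\<close> count.\<close>

definition detf :: "nat \<Rightarrow> (nat \<Rightarrow> nat \<Rightarrow> real) \<Rightarrow> real" where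
  "detf n V = Determinant.det (mat n n (\<lambda>(i, j). V i j))"

definition sqn :: "nat \<Rightarrow> (nat \<Rightarrow> real) \<Rightarrow> real" where
  "sqn n x = (\<Sum>j<n. (x j)\<^sup>2)"

definition dot :: "nat \<Rightarrow> (nat \<Rightarrow> real) \<Rightarrow> (nat \<Rightarrow> real) \<Rightarrow> real" where
  "dot n x y = (\<Sum>j<n. x j * y j)"

lemma detf_mult: "detf n (\<lambda>i k. \<Sum>j<n. A i j * V j k) = detf n A * detf n V"
proof -
  have "mat n n (\<lambda>(i, k). \<Sum>j<n. A i j * V j k) = mat n n (\<lambda>(i, j). A i j) * mat n n (\<lambda>(i, j). V i j)"
    by (rule eq_matI) (auto simp: scalar_prod_def lessThan_atLeast0)
  then show ?thesis
    unfolding detf_def by (simp add: det_mult[of _ n])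
qed

lemma detf_diag:
  "detf n (\<lambda>i j. if i = j then d i else 0) = (\<Prod>i<n. d i)"
proof -
  have "detf n (\<lambda>i j. if i = j then d i else 0) = prod_list (diag_mat (mat n n (\<lambda>(i, j). if i = j then d i else 0)))"
    unfolding detf_def by (rule det_upper_triangular[where n=n]) auto
  also have "\<dots> = (\<Prod>i<n. d i)"
    by (simp add: prod_list_diag_prod lessThan_atLeast0)
  finally show ?thesis .
qed

lemma detf_cong: "(\<And>i j. i < n \<Longrightarrow> j < n \<Longrightarrow> A i j = B i j) \<Longrightarrow> detf n A = detf n B"
  unfolding detf_def by (rule arg_cong[where f=Determinant.det], rule eq_matI) auto

text \<open>The Leibniz formula has \<open>n!\<close> terms of size at most \<open>b ^ n\<close>,
  and \<open>n!\<close> is at most \<open>n ^ n\<close>. The loss against Hadamard's inequality is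
  at most of order \<open>ln n\<close> per dimension after taking logarithms.\<close>

lemma detf_bound:
  assumes b: "\<And>i j. i < n \<Longrightarrow> j < n \<Longrightarrow> \<bar>A i j\<bar> \<le> b" and b0: "0 \<le> b"
  shows "\<bar>detf n A\<bar> \<le> (real n * b) ^ n"
proof -
  let ?P = "{p. p permutes {0 ..< n}}"
  have "\<bar>detf n A\<bar> = \<bar>\<Sum>p\<in>?P. signof p * (\<Prod>i = 0..<n. A i (p i))\<bar>"
    unfolding detf_def by (subst det_def'[where n=n]) (auto intro!: arg_cong[where f=abs] sum.cong prod.cong)
  also have "\<dots> \<le> (\<Sum>p\<in>?P. \<bar>signof p * (\<Prod>i = 0..<n. A i (p i))\<bar>)"
    by (rule sum_abs)
  also have "\<dots> \<le> (\<Sum>p\<in>?P. b ^ n)"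
  proof (rule sum_mono)
    fix p assume p: "p \<in> ?P"
    have "\<bar>signof p * (\<Prod>i = 0..<n. A i (p i))\<bar> = (\<Prod>i = 0..<n. \<bar>A i (p i)\<bar>)"
      by (auto simp: abs_mult abs_prod sign_def)
    also have "\<dots> \<le> (\<Prod>i = 0..<n. b)"
      using p permutes_in_image[of p "{0..<n}"] by (intro prod_mono) (auto intro!: b)
    finally show "\<bar>signof p * (\<Prod>i = 0..<n. A i (p i))\<bar> \<le> b ^ n" by simp
  qed
  also have "\<dots> = fact n * b ^ n"
    by (simp add: card_permutations)
  also have "\<dots> \<le> real n ^ n * b ^ n"
    using fact_le_power[of n] b0 by (intro mult_right_mono) auto
  finally show ?thesis by (simp add: power_mult_distrib)
qed

text \<open>Cramer's rule, transposed since the vectors are rows here. In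
  \<open>large_simplex\<close> it turns near-maximality of a determinant into bounds on
  coordinates.\<close>

lemma detf_cramer:
  assumes k: "k < n" and x: "\<And>i. i < n \<Longrightarrow> x i = (\<Sum>j<n. y j * V j i)"
  shows "detf n (V(k := x)) = y k * detf n V"
proof -
  let ?A = "mat n n (\<lambda>(i, j). V j i)"
  have A: "?A \<in> carrier_mat n n" by simp
  have "transpose_mat (mat n n (\<lambda>(i, j). (V(k := x)) i j)) = replace_col ?A (?A *\<^sub>v vec n y) k"
    by (rule eq_matI)
       (auto simp: replace_col_def x scalar_prod_def lessThan_atLeast0 mult.commute intro!: sum.cong)
  moreover have "transpose_mat (mat n n (\<lambda>(i, j). V i j)) = ?A"
    by (rule eq_matI) auto
  ultimately show ?thesis
    unfolding detf_def using cramer_lemma_mat[OF A, of "vec n y" k] k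
    by (metis det_transpose index_vec mat_carrier vec_carrier)
qed

lemma detf_solve:
  assumes d: "detf n V \<noteq> 0"
  shows "\<exists>y. \<forall>i<n. x i = (\<Sum>j<n. y j * V j i)"
proof -
  let ?A = "mat n n (\<lambda>(i, j). V j i)"
  have A: "?A \<in> carrier_mat n n" by simp
  have t: "transpose_mat (mat n n (\<lambda>(i, j). V i j)) = ?A"
    by (rule eq_matI) auto
  have "Determinant.det ?A \<noteq> 0"
    using d unfolding detf_def by (metis t det_transpose mat_carrier)
  then obtain B where B: "B \<in> carrier_mat n n" "?A * B = 1\<^sub>m n"
    using det_non_zero_imp_unit[OF A] unfolding Units_def ring_mat_def by auto
  define z where "z = B *\<^sub>v vec n x"
  have z: "z \<in> carrier_vec n" using B unfolding z_def by simp
  have "?A *\<^sub>v z = (?A * B) *\<^sub>v vec n x"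
    unfolding z_def using A B by (intro assoc_mult_mat_vec[symmetric]) auto
  also have "\<dots> = vec n x" using B by simp
  finally have eq: "?A *\<^sub>v z = vec n x" .
  show ?thesis
  proof (intro exI[of _ "\<lambda>j. z $ j"] allI impI)
    fix i assume i: "i < n"
    have "x i = (?A *\<^sub>v z) $ i" using eq i by simp
    also have "\<dots> = (\<Sum>j<n. z $ j * V j i)"
      using i z by (auto simp: scalar_prod_def lessThan_atLeast0 mult.commute intro!: sum.cong)
    finally show "x i = (\<Sum>j<n. z $ j * V j i)" .
  qed
qed

section \<open>Cutting an ellipsoid\<close>

text \<open>The rows of \<open>V\<close> are the images of the unit vectors under the linear part,
  and only the first \<open>n\<close> entries of \<open>y\<close> enter. The value 0 from index
  \<open>n\<close> on keeps the images in the model of R^n.\<close>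

definition emap :: "nat \<Rightarrow> (nat \<Rightarrow> real) \<Rightarrow> (nat \<Rightarrow> nat \<Rightarrow> real) \<Rightarrow> (nat \<Rightarrow> real) \<Rightarrow> nat \<Rightarrow> real" where
  "emap n c V y = (\<lambda>k. if k < n then c k + (\<Sum>j<n. y j * V j k) else 0)"

text \<open>\<open>H\<close> is the reflection that exchanges \<open>u\<close> and the first unit
  vector \<open>e_0\<close>, namely \<open>I - 2 w w^T / |w|^2\<close> with
  \<open>w = u - e_0\<close>. It is symmetric and its own inverse, so its determinant has square
  1.\<close>

lemma householder:
  assumes n: "0 < n" and u: "sqn n u = 1"
  obtains H :: "nat \<Rightarrow> nat \<Rightarrow> real" where
    "\<And>y. sqn n (\<lambda>i. \<Sum>j<n. H i j * y j) = sqn n y"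
    "\<And>y. (\<Sum>j<n. H 0 j * y j) = dot n u y"
    "\<And>j. j < n \<Longrightarrow> H 0 j = u j"
    "\<And>y j. j < n \<Longrightarrow> (\<Sum>i<n. H i j * (\<Sum>k<n. H i k * y k)) = y j"
    "\<bar>detf n H\<bar> = 1"
proof -
  define w where "w j = u j - (if j = 0 then 1 else 0)" for j
  define W where "W = sqn n w"
  have delta: "(\<Sum>j<n. (if i = j then (1::real) else 0) * y j) = y i" if "i < n" for i y
    using that by (simp add: if_distrib[of "\<lambda>x. x * _"] cong: if_cong)
  have W_eq: "W = 2 - 2 * u 0"
  proof -
    have "W = (\<Sum>j<n. (u j)\<^sup>2 + (if 0 = j then 1 else 0) * (1 - 2 * u j))"
      unfolding W_def sqn_def w_def by (rule sum.cong) (auto simp: power2_eq_square algebra_simps)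
    also have "\<dots> = sqn n u + (1 - 2 * u 0)"
      unfolding sum.distrib using n by (subst delta) (auto simp: sqn_def)
    finally show ?thesis using u by simp
  qed
  \<comment> \<open>The value 0 covers \<open>u = e_0\<close>, where \<open>H\<close> is the
    identity. The relation \<open>a * (a * W) = 2 * a\<close> holds in both cases and is all that
    the isometry and the inverse formula use about \<open>a\<close>.\<close>
  define a where "a = (if W = 0 then 0 else 2 / W)"
  define H where "H i j = (if i = j then 1 else 0) - a * w i * w j" for i j
  have Hy: "(\<Sum>j<n. H i j * y j) = y i - a * dot n w y * w i" if "i < n" for i y
  proof -
    have "(\<Sum>j<n. H i j * y j) = (\<Sum>j<n. (if i = j then 1 else 0) * y j) - (\<Sum>j<n. a * w i * (w j * y j))"
      unfolding H_def by (simp add: algebra_simps sum_subtractf sum.distrib)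
    also have "\<dots> = y i - a * w i * dot n w y"
      using that by (simp add: delta dot_def sum_distrib_left)
    finally show ?thesis by (simp add: algebra_simps)
  qed
  have Hsym: "H i j = H j i" for i j unfolding H_def by auto
  have aW: "a * (a * W) = 2 * a" unfolding a_def by auto
  have ww: "dot n w w = W" unfolding dot_def W_def sqn_def by (simp add: power2_eq_square)
  have dot_minus: "dot n w (\<lambda>k. y k - b * w k) = dot n w y - b * W" for y b
    unfolding ww[symmetric] unfolding dot_def
    by (simp add: algebra_simps sum_subtractf sum_distrib_left)
  have inv: "(\<Sum>k<n. H j k * (\<Sum>l<n. H k l * y l)) = y j" if j: "j < n" for y j
  proof -
    have "(\<Sum>k<n. H j k * (\<Sum>l<n. H k l * y l)) = (\<Sum>k<n. H j k * (y k - a * dot n w y * w k))"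
      by (rule sum.cong) (auto simp: Hy)
    also have "\<dots> = (y j - a * dot n w y * w j) - a * dot n w (\<lambda>k. y k - a * dot n w y * w k) * w j"
      using j by (subst Hy) auto
    also have "dot n w (\<lambda>k. y k - a * dot n w y * w k) = dot n w y - a * dot n w y * W"
      by (rule dot_minus)
    also have "y j - a * dot n w y * w j - a * (dot n w y - a * dot n w y * W) * w j
       = y j + (a * (a * W) - 2 * a) * dot n w y * w j"
      by (simp add: algebra_simps)
    finally show ?thesis using aW by simp
  qed
  have w0: "w 0 = - W / 2" unfolding w_def W_eq by simp
  have Wz: "w j = 0" if "W = 0" "j < n" for j
    using that unfolding W_def sqn_def by (subst (asm) sum_nonneg_eq_0_iff) auto
  have H0: "H 0 j = u j" if j: "j < n" for j
  proof (cases "W = 0")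
    case True
    then show ?thesis using Wz[OF _ j] unfolding H_def w_def by (auto simp: a_def)
  next
    case False
    then have "a * w 0 = -1" unfolding a_def w0 by simp
    then have "H 0 j = (if 0 = j then 1 else 0) + w j" unfolding H_def by simp
    then show ?thesis unfolding w_def by auto
  qed
  have det2: "detf n H * detf n H = 1"
  proof -
    have "detf n H * detf n H = detf n (\<lambda>i k. \<Sum>j<n. H i j * H j k)"
      by (simp add: detf_mult)
    also have "\<dots> = detf n (\<lambda>i j. if i = j then 1 else 0)"
    proof (rule detf_cong)
      fix i k assume i: "i < n" and k: "k < n"
      have "(\<Sum>j<n. H i j * H j k) = (\<Sum>j<n. H i j * (\<Sum>l<n. H j l * (if k = l then 1 else 0)))"
        using k by (intro sum.cong refl) (simp add: if_distrib cong: if_cong)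
      also have "\<dots> = (if k = i then 1 else 0)" by (rule inv[OF i])
      finally show "(\<Sum>j<n. H i j * H j k) = (if i = k then 1 else 0)" by auto
    qed
    also have "\<dots> = 1" by (subst detf_diag) simp
    finally show ?thesis .
  qed
  show ?thesis
  proof
    fix y
    have "sqn n (\<lambda>i. \<Sum>j<n. H i j * y j) = (\<Sum>i<n. (y i)\<^sup>2 - 2 * a * dot n w y * (w i * y i) + (a * dot n w y)\<^sup>2 * (w i)\<^sup>2)"
      unfolding sqn_def by (rule sum.cong, simp, simp only: lessThan_iff Hy) (simp add: power2_eq_square algebra_simps)
    also have "\<dots> = sqn n y - 2 * a * dot n w y * dot n w y + (a * dot n w y)\<^sup>2 * W"
      by (simp add: sum.distrib sum_subtractf sum_distrib_left[symmetric] sqn_def W_def dot_def)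
    also have "\<dots> = sqn n y + (a * (a * W) - 2 * a) * (dot n w y)\<^sup>2"
      by (simp add: power2_eq_square algebra_simps)
    finally show "sqn n (\<lambda>i. \<Sum>j<n. H i j * y j) = sqn n y" using aW by simp
  next
    fix y show "(\<Sum>j<n. H 0 j * y j) = dot n u y"
      unfolding dot_def by (rule sum.cong) (auto simp: H0)
  next
    fix y j assume "j < n"
    then show "(\<Sum>i<n. H i j * (\<Sum>k<n. H i k * y k)) = y j"
      using inv[of j y] by (simp add: Hsym[of _ j])
  next
    show "\<bar>detf n H\<bar> = 1"
    proof -
      have "(detf n H)\<^sup>2 = 1" using det2 by (simp add: power2_eq_square)
      then show ?thesis by (auto simp: power2_eq_1_iff)
    qed
  qed (rule H0)
qed

text \<open>The new semi-axes \<open>t\<close> and \<open>s\<close> are chosen such that the new ellipsoid passes through the pole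
  \<open>- u\<close> and through the rim of the cap that is cut off.\<close>

lemma ellipsoid_cut:
  assumes n: "0 < n" and u: "sqn n u = 1" and V: "detf n V \<noteq> 0"
  obtains c' V' where "detf n V' \<noteq> 0"
    "ln \<bar>detf n V'\<bar> \<le> ln \<bar>detf n V\<bar> - 1 / (16 * real n)"
    "\<And>y. sqn n y \<le> 1 \<Longrightarrow> dot n u y \<le> 1 / (8 * real n) \<Longrightarrow>
       \<exists>y'. sqn n y' \<le> 1 \<and> emap n c V y = emap n c' V' y'"
proof -
  obtain H where H: "\<And>y. sqn n (\<lambda>i. \<Sum>j<n. H i j * y j) = sqn n y"
    "\<And>y. (\<Sum>j<n. H 0 j * y j) = dot n u y"
    "\<And>j. j < n \<Longrightarrow> H 0 j = u j"
    "\<And>y j. j < n \<Longrightarrow> (\<Sum>i<n. H i j * (\<Sum>k<n. H i k * y k)) = y j"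
    "\<bar>detf n H\<bar> = 1"
    by (rule householder[OF n u]) blast
  \<comment> \<open>\<open>g\<close> is the depth of the cut: the retained cap reaches height
    \<open>g\<close> beyond the centre in direction \<open>u\<close>, and the new centre lies at
    height \<open>- g\<close>.\<close>
  define g where "g = 1 / (8 * real n)"
  define t where "t = 1 - g"
  \<comment> \<open>At the rim, the equation
    \<open>4 * g\<^sup>2 / t\<^sup>2 + (1 - g\<^sup>2) / s\<^sup>2 = 1\<close> solves to this
    value.\<close>
  define s where "s = sqrt (t ^ 3 / (1 - 3 * g))"
  have g: "0 < g" "g \<le> 1 / 8" using n unfolding g_def by (auto simp: field_simps)
  have t: "0 < t" using g unfolding t_def by simp
  have g3: "0 < 1 - 3 * g" using g by simp
  have s2: "s\<^sup>2 = t ^ 3 / (1 - 3 * g)" unfolding s_def using t g3 by simp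
  have s: "0 < s" unfolding s_def using t g3 by simp
  define d where "d i = (if i = 0 then t else s)" for i :: nat
  have d: "d i > 0" for i using s t unfolding d_def by simp
  define V' where "V' i k = (\<Sum>j<n. (d i * H i j) * V j k)" for i k
  define c' where "c' k = c k - g * (\<Sum>j<n. u j * V j k)" for k
  have dH: "detf n (\<lambda>i j. d i * H i j) = (\<Prod>i<n. d i) * detf n H"
  proof -
    have "detf n (\<lambda>i j. d i * H i j) = detf n (\<lambda>i k. \<Sum>j<n. (if i = j then d i else 0) * H j k)"
      by (rule detf_cong) (simp add: if_distrib[of "\<lambda>x. x * _"] cong: if_cong)
    then show ?thesis by (simp add: detf_mult detf_diag)
  qed
  have prodd: "(\<Prod>i<n. d i) = t * s ^ (n - 1)"
  proof -
    obtain m where m: "n = Suc m" using n by (cases n) auto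
    show ?thesis unfolding m d_def by (subst prod.lessThan_Suc_shift) simp
  qed
  have dV: "\<bar>detf n V'\<bar> = t * s ^ (n - 1) * \<bar>detf n V\<bar>"
    unfolding V'_def detf_mult dH prodd using H(5) s t by (simp add: abs_mult)
  show ?thesis
  proof
    show "detf n V' \<noteq> 0" using dV V s t by auto
  next
    have "s\<^sup>2 \<le> 1 + 5 * g\<^sup>2"
    proof -
      have "0 \<le> g\<^sup>2 * (2 - 14 * g)" using g by (intro mult_nonneg_nonneg) auto
      then have "t ^ 3 \<le> (1 + 5 * g\<^sup>2) * (1 - 3 * g)"
        unfolding t_def by (simp add: power2_eq_square power3_eq_cube algebra_simps)
      then show ?thesis unfolding s2 using g3 by (simp add: pos_divide_le_eq)
    qed
    then have "ln (s\<^sup>2) \<le> ln (1 + 5 * g\<^sup>2)" using s by (subst ln_le_cancel_iff) (auto simp: add_pos_nonneg)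
    also have "\<dots> \<le> 5 * g\<^sup>2" by (rule ln_add_one_self_le_self) simp
    finally have lns: "ln s \<le> 5 / 2 * g\<^sup>2" using s by (simp add: ln_realpow)
    have lnt: "ln t \<le> - g" using ln_le_minus_one[of t] t unfolding t_def by simp
    \<comment> \<open>The axis along \<open>u\<close> loses at least \<open>g\<close> in the
      logarithm, and each other axis gains at most \<open>5 / 2 * g\<^sup>2\<close>. A depth of
      order \<open>1 / n\<close> keeps the total gain below \<open>g / 2\<close>.\<close>
    have gn: "real (n - 1) * g \<le> 1 / 8" unfolding g_def using n by (simp add: field_simps)
    have "ln \<bar>detf n V'\<bar> = ln t + real (n - 1) * ln s + ln \<bar>detf n V\<bar>"
      unfolding dV using s t V by (simp add: ln_mult ln_realpow)
    also have "real (n - 1) * ln s \<le> real (n - 1) * (5 / 2 * g\<^sup>2)"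
      by (rule mult_left_mono[OF lns]) simp
    also have "real (n - 1) * (5 / 2 * g\<^sup>2) = 5 / 2 * g * (real (n - 1) * g)"
      by (simp add: power2_eq_square)
    also have "\<dots> \<le> 5 / 2 * g * (1 / 8)" using g by (intro mult_left_mono[OF gn]) auto
    finally have "ln \<bar>detf n V'\<bar> \<le> - g + 5 / 2 * g * (1 / 8) + ln \<bar>detf n V\<bar>" using lnt by simp
    also have "\<dots> \<le> ln \<bar>detf n V\<bar> - g / 2" using g by simp
    finally show "ln \<bar>detf n V'\<bar> \<le> ln \<bar>detf n V\<bar> - 1 / (16 * real n)" unfolding g_def by simp
  next
    fix y assume y: "sqn n y \<le> 1" and uy: "dot n u y \<le> 1 / (8 * real n)"
    define z where "z i = (\<Sum>j<n. H i j * y j)" for i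
    have z1: "sqn n z \<le> 1" using H(1)[of y] y unfolding z_def by simp
    have z0: "z 0 \<le> g" using H(2)[of y] uy unfolding z_def g_def by simp
    define y' where "y' i = (z i + (if i = 0 then g else 0)) / d i" for i
    have pt: "(\<Sum>i<n. y' i * V' i k) = (\<Sum>j<n. y j * V j k) + g * (\<Sum>j<n. u j * V j k)" for k
    proof -
      have yd: "y' i * (d i * H i j * V j k) = (z i + (if i = 0 then g else 0)) * H i j * V j k" for i j
        using d[of i] unfolding y'_def by simp
      have "(\<Sum>i<n. y' i * V' i k) = (\<Sum>i<n. \<Sum>j<n. (z i + (if i = 0 then g else 0)) * H i j * V j k)"
        unfolding V'_def sum_distrib_left yd ..
      also have "\<dots> = (\<Sum>j<n. \<Sum>i<n. (z i + (if i = 0 then g else 0)) * H i j * V j k)"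
        by (rule sum.swap)
      also have "\<dots> = (\<Sum>j<n. (y j + g * u j) * V j k)"
      proof (rule sum.cong[OF refl])
        fix j assume j: "j \<in> {..<n}"
        have "(\<Sum>i<n. (z i + (if i = 0 then g else 0)) * H i j * V j k)
          = (\<Sum>i<n. H i j * z i) * V j k + (\<Sum>i<n. if i = 0 then g * H i j * V j k else 0)"
          unfolding sum_distrib_right sum.distrib[symmetric] by (rule sum.cong) (auto simp: algebra_simps)
        also have "(\<Sum>i<n. H i j * z i) = y j" unfolding z_def using H(4) j by simp
        also have "(\<Sum>i<n. if i = 0 then g * H i j * V j k else 0) = g * u j * V j k"
          using n H(3)[of j] j by simp
        finally show "(\<Sum>i<n. (z i + (if i = 0 then g else 0)) * H i j * V j k) = (y j + g * u j) * V j k"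
          by (simp add: algebra_simps)
      qed
      finally show ?thesis by (simp add: algebra_simps sum.distrib sum_distrib_left)
    qed
    have "emap n c V y = emap n c' V' y'"
      unfolding emap_def c'_def pt by auto
    moreover have "sqn n y' \<le> 1"
    proof -
      obtain m where m: "n = Suc m" using n by (cases n) auto
      define R where "R = (\<Sum>i<m. (z (Suc i))\<^sup>2)"
      have sz: "sqn n z = (z 0)\<^sup>2 + R" unfolding sqn_def m R_def by (subst sum.lessThan_Suc_shift) simp
      have R0: "0 \<le> R" unfolding R_def by (intro sum_nonneg) auto
      have "sqn n y' = (z 0 + g)\<^sup>2 / t\<^sup>2 + R / s\<^sup>2"
        unfolding sqn_def m R_def
        by (subst sum.lessThan_Suc_shift) (simp add: y'_def d_def power_divide sum_divide_distrib)
      also have "R / s\<^sup>2 \<le> (1 - (z 0)\<^sup>2) / s\<^sup>2" using z1 sz by (intro divide_right_mono) auto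
      also have "(1 - (z 0)\<^sup>2) / s\<^sup>2 = (1 - (z 0)\<^sup>2) * (1 - 3 * g) / (t * t\<^sup>2)"
        unfolding s2 by (simp add: power3_eq_cube power2_eq_square)
      also have "(z 0 + g)\<^sup>2 / t\<^sup>2 + (1 - (z 0)\<^sup>2) * (1 - 3 * g) / (t * t\<^sup>2)
         = ((z 0 + g)\<^sup>2 * t + (1 - (z 0)\<^sup>2) * (1 - 3 * g)) / (t * t\<^sup>2)"
        using t by (simp add: add_divide_distrib)
      also have "\<dots> \<le> 1"
      proof -
        have "(z 0)\<^sup>2 \<le> 1" using z1 sz R0 by linarith
        then have "-1 \<le> z 0" using abs_le_square_iff[of "z 0" 1] by auto
        \<comment> \<open>This product is exactly the slack of the inequality to be shown; it
          vanishes at the pole \<open>z 0 = -1\<close> and on the rim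
          \<open>z 0 = g\<close>.\<close>
        then have "0 \<le> 2 * g * ((z 0 + 1) * (g - z 0))" using z0 g by (intro mult_nonneg_nonneg) auto
        then have "(z 0 + g)\<^sup>2 * t + (1 - (z 0)\<^sup>2) * (1 - 3 * g) \<le> t * t\<^sup>2"
          unfolding t_def by (simp add: power2_eq_square algebra_simps)
        then show ?thesis using t by (simp add: pos_divide_le_eq)
      qed
      finally show ?thesis by simp
    qed
    ultimately show "\<exists>y'. sqn n y' \<le> 1 \<and> emap n c V y = emap n c' V' y'" by blast
  qed
qed

section \<open>Detection near a maximum of a penalized logarithm\<close>

lemma scaleR_fun_apply [simp]: "(r *\<^sub>R f) i = r *\<^sub>R (f i)"
  by (simp add: scaleR_fun_def)

lemma sum_fun_apply: "(\<Sum>a\<in>A. f a) i = (\<Sum>a\<in>A. f a i)"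
  by (induction A rule: infinite_finite_induct) auto

lemma sqn_nonneg [simp]: "0 \<le> sqn n x"
  unfolding sqn_def by (intro sum_nonneg) auto

lemma dot_self: "dot n x x = sqn n x"
  unfolding dot_def sqn_def by (simp add: power2_eq_square)

lemma dot_Cauchy_Schwarz: "(dot n x y)\<^sup>2 \<le> sqn n x * sqn n y"
  unfolding dot_def sqn_def by (rule Cauchy_Schwarz_ineq_sum)

lemma dot_le_sqrt: "\<bar>dot n x y\<bar> \<le> sqrt (sqn n x) * sqrt (sqn n y)"
  using real_sqrt_le_mono[OF dot_Cauchy_Schwarz[of n x y]] by (simp add: real_sqrt_mult)

lemma sqn_add: "sqn n (\<lambda>i. x i + t * y i) = sqn n x + 2 * t * dot n x y + t\<^sup>2 * sqn n y"
  unfolding sqn_def dot_def sum_distrib_left sum.distrib[symmetric]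
  by (rule sum.cong) (auto simp: power2_eq_square algebra_simps)

lemma sqrt_sqn_triangle: "sqrt (sqn n (\<lambda>i. x i + y i)) \<le> sqrt (sqn n x) + sqrt (sqn n y)"
  using L2_set_triangle_ineq[of x y "{..<n}"] unfolding L2_set_def sqn_def .

lemma sqn_scale: "sqn n (\<lambda>i. t * x i) = t\<^sup>2 * sqn n x"
  unfolding sqn_def by (simp add: power_mult_distrib sum_distrib_left)

lemma sum_abs_le_sqn: "(\<Sum>j<n. \<bar>v j\<bar>)\<^sup>2 \<le> real n * sqn n v"
  using Cauchy_Schwarz_ineq_sum[of "\<lambda>_. 1" "\<lambda>j. \<bar>v j\<bar>" "{..<n}"] by (simp add: sqn_def)

definition supp_below :: "nat \<Rightarrow> (nat \<Rightarrow> real) set" where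
  "supp_below n = {y. \<forall>i\<ge>n. y i = 0}"

lemma compact_box: "compact {y \<in> supp_below n. \<forall>i. \<bar>y i\<bar> \<le> b}"
proof -
  \<comment> \<open>Intersecting with \<open>{- b..b}\<close> makes a factor empty for negative
    \<open>b\<close>, when the box is empty too.\<close>
  define S where "S i = (if i < n then {- b..b} else {0 :: real} \<inter> {- b..b})" for i
  have "compactin (product_topology (\<lambda>i. euclidean) UNIV) (Pi\<^sub>E UNIV S)"
    by (subst compactin_PiE) (auto simp: S_def)
  then have "compact (Pi\<^sub>E UNIV S)"
    by (simp add: euclidean_product_topology)
  moreover have "y i \<in> S i \<longleftrightarrow> \<bar>y i\<bar> \<le> b \<and> (n \<le> i \<longrightarrow> y i = 0)" for y i
    unfolding S_def by auto
  then have "Pi\<^sub>E UNIV S = {y \<in> supp_below n. \<forall>i. \<bar>y i\<bar> \<le> b}"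
    unfolding supp_below_def PiE_UNIV_domain Pi_def by auto
  ultimately show ?thesis by simp
qed

lemma continuous_on_coord [continuous_intros]: "continuous_on S (\<lambda>y. y i :: real)"
  by (rule continuous_on_subset[OF continuous_on_product_coordinates]) simp

text \<open>The ball is a closed part of a box of half-width \<open>1 + r\<close>, because
  \<open>\<bar>y i\<bar> \<le> 1 + (y i)\<^sup>2\<close>.\<close>

lemma compact_ball: "compact {y \<in> supp_below n. sqn n y \<le> r}"
proof -
  have "\<bar>y i\<bar> \<le> 1 + r" if "y \<in> supp_below n" "sqn n y \<le> r" for y i
  proof (cases "i < n")
    case True
    have "(y i)\<^sup>2 \<le> sqn n y" unfolding sqn_def
      using True by (intro member_le_sum) auto
    then have "(y i)\<^sup>2 \<le> r" using that by simp
    moreover have "\<bar>y i\<bar> \<le> 1 + (y i)\<^sup>2"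
      using zero_le_power2[of "\<bar>y i\<bar> - 1"] zero_le_power2[of "y i"] unfolding power2_diff by simp
    ultimately show ?thesis by simp
  next
    case False
    then have "y i = 0" using that unfolding supp_below_def by auto
    moreover have "0 \<le> r" using that sqn_nonneg[of n y] by linarith
    ultimately show ?thesis by simp
  qed
  then have "{y \<in> supp_below n. sqn n y \<le> r}
    = {y \<in> supp_below n. \<forall>i. \<bar>y i\<bar> \<le> 1 + r} \<inter> {y. sqn n y \<le> r}" by auto
  moreover have "closed {y. sqn n y \<le> r}"
    unfolding sqn_def by (intro closed_Collect_le continuous_intros)
  ultimately show ?thesis using compact_Int_closed[OF compact_box] by simp
qed

text \<open>Convexity with weights \<open>1 / (1 + t)\<close> and \<open>t / (1 + t)\<close>,
  cleared of denominators. It serves for extrapolation: a lower bound at \<open>w\<close> and an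
  upper bound at \<open>x\<close> give a lower bound at \<open>y\<close>.\<close>

lemma convex_on_ratio:
  assumes "convex_on D G" "x \<in> D" "y \<in> D" "0 \<le> t" "\<And>i. (1 + t) * w i = x i + t * y i"
  shows "(1 + t) * G w \<le> G x + t * G y"
proof -
  have w: "w = (1 / (1 + t)) *\<^sub>R x + (t / (1 + t)) *\<^sub>R y"
  proof
    fix i
    have "w i = (x i + t * y i) / (1 + t)"
      using assms(4) assms(5)[of i] by (simp add: eq_divide_eq mult.commute)
    then show "w i = ((1 / (1 + t)) *\<^sub>R x + (t / (1 + t)) *\<^sub>R y) i"
      by (simp add: add_divide_distrib)
  qed
  have "1 / (1 + t) + t / (1 + t) = 1" using assms(4) by (simp add: add_divide_distrib[symmetric])
  moreover have "\<forall>u\<ge>0. \<forall>v\<ge>0. u + v = 1 \<longrightarrow> G (u *\<^sub>R x + v *\<^sub>R y) \<le> u * G x + v * G y"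
    using assms(1-3) unfolding convex_on_def by blast
  ultimately have "G w \<le> (1 / (1 + t)) * G x + (t / (1 + t)) * G y"
    using assms(4) unfolding w by (metis divide_nonneg_nonneg add_nonneg_nonneg zero_le_one)
  also have "\<dots> = (G x + t * G y) / (1 + t)" by (simp add: add_divide_distrib)
  finally show ?thesis using assms(4) by (simp add: field_simps)
qed

text \<open>For negative \<open>z\<close>, the product of \<open>1 + z + z\<^sup>2\<close> and
  \<open>1 - z\<close> is \<open>1 - z ^ 3\<close>, hence at least 1, and \<open>1 - z\<close> is at
  most \<open>exp (- z)\<close>.\<close>

lemma exp_le_quadratic: "exp z \<le> 1 + z + z\<^sup>2" if "\<bar>z\<bar> \<le> 1" for z :: real
proof (cases "0 \<le> z")
  case True
  then show ?thesis using that exp_bound by auto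
next
  case False
  have "z ^ 3 \<le> 0" using False by (simp add: power_le_zero_eq)
  then have "1 \<le> 1 - z ^ 3" by simp
  also have "1 - z ^ 3 = (1 + z + z\<^sup>2) * (1 - z)" by (simp add: power2_eq_square power3_eq_cube algebra_simps)
  also have "\<dots> \<le> (1 + z + z\<^sup>2) * exp (- z)"
    using that exp_ge_add_one_self[of "- z"] by (intro mult_left_mono) auto
  finally show ?thesis by (simp add: exp_minus field_simps)
qed

text \<open>The logarithm exceeds its value at the origin by at most \<open>L\<close>, while the
  penalty \<open>a * sqn n y\<close> equals \<open>L\<close> at radius \<open>\<rho> / 2\<close>; a
  maximizer therefore stays within that radius. Exponentiating maximality bounds \<open>F\<close>
  relative to \<open>F X + \<epsilon>\<close>.\<close>

lemma log_quadratic_maximum: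
  fixes F :: "(nat \<Rightarrow> real) \<Rightarrow> real"
  assumes ball: "\<And>y. y \<in> supp_below n \<Longrightarrow> sqn n y \<le> \<rho>\<^sup>2 \<Longrightarrow> y \<in> D"
    and cont: "continuous_on {y \<in> supp_below n. sqn n y \<le> \<rho>\<^sup>2} F"
    and F0: "\<And>y. y \<in> D \<Longrightarrow> 0 \<le> F y" and osc: "\<And>y. y \<in> D \<Longrightarrow> F y \<le> F (\<lambda>_. 0) + 1"
    and e: "0 < \<epsilon>" and L: "ln (1 + 1 / \<epsilon>) \<le> L" and rho: "0 < \<rho>" and a: "a = 4 * L / \<rho>\<^sup>2"
  shows "\<exists>X\<in>supp_below n. sqn n X \<le> (\<rho> / 2)\<^sup>2 \<and>
    (\<forall>y\<in>supp_below n. sqn n y \<le> \<rho>\<^sup>2 \<longrightarrow>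
       F y + \<epsilon> \<le> (F X + \<epsilon>) * exp (a * (sqn n y - sqn n X)))"
proof -
  let ?C = "{y \<in> supp_below n. sqn n y \<le> \<rho>\<^sup>2}"
  define \<Psi> where "\<Psi> y = ln (F y + \<epsilon>) - a * sqn n y" for y
  have pos: "0 < F y + \<epsilon>" if "y \<in> ?C" for y
  proof -
    have "0 \<le> F y" using that by (intro F0 ball) auto
    then show ?thesis using e by simp
  qed
  have Lpos: "0 < L" 
  proof -
    have "0 < ln (1 + 1 / \<epsilon>)" using e by (intro ln_gt_zero) simp
    then show ?thesis using L by linarith
  qed
  have apos: "0 < a" unfolding a using Lpos rho by simp
  have "continuous_on ?C (\<lambda>y. ln (F y + \<epsilon>))"
    using pos by (intro continuous_on_ln continuous_on_add cont continuous_on_const) force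
  moreover have "continuous_on ?C (\<lambda>y. a * sqn n y)"
    unfolding sqn_def[abs_def] by (intro continuous_intros)
  ultimately have "continuous_on ?C \<Psi>"
    unfolding \<Psi>_def by (rule continuous_on_diff)
  moreover have z: "(\<lambda>_. 0) \<in> ?C" by (simp add: supp_below_def sqn_def)
  ultimately have "\<exists>X\<in>?C. \<forall>y\<in>?C. \<Psi> y \<le> \<Psi> X"
    by (intro continuous_attains_sup[OF compact_ball]) blast+
  then obtain X where X: "X \<in> ?C" and max: "\<And>y. y \<in> ?C \<Longrightarrow> \<Psi> y \<le> \<Psi> X"
    by blast
  have z0: "F (\<lambda>_. 0) + \<epsilon> > 0" by (rule pos[OF z])
  have "a * sqn n X \<le> ln (F X + \<epsilon>) - ln (F (\<lambda>_. 0) + \<epsilon>)"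
    using max[OF z] unfolding \<Psi>_def by (simp add: sqn_def)
  also have "\<dots> = ln ((F X + \<epsilon>) / (F (\<lambda>_. 0) + \<epsilon>))"
    using pos[OF X] z0 by (simp add: ln_div)
  also have "\<dots> \<le> ln (1 + 1 / \<epsilon>)"
  proof (subst ln_le_cancel_iff)
    show "0 < (F X + \<epsilon>) / (F (\<lambda>_. 0) + \<epsilon>)" using pos[OF X] z0 by simp
    show "0 < 1 + 1 / \<epsilon>" using e by (simp add: add_pos_pos)
    \<comment> \<open>The worst case is \<open>F\<close> vanishing at the origin, which explains the
      ratio \<open>1 + 1 / \<epsilon>\<close>.\<close>
    have "F (\<lambda>_. 0) \<ge> 0" using F0 ball z by auto
    then have "F (\<lambda>_. 0) + 1 + \<epsilon> \<le> (1 + 1 / \<epsilon>) * (F (\<lambda>_. 0) + \<epsilon>)"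
      using e by (simp add: field_simps)
    then show "(F X + \<epsilon>) / (F (\<lambda>_. 0) + \<epsilon>) \<le> 1 + 1 / \<epsilon>"
      using osc[of X] ball X z0 by (simp add: pos_divide_le_eq)
  qed
  finally have "a * sqn n X \<le> L" using L by simp
  then have "sqn n X \<le> (\<rho> / 2)\<^sup>2"
    using Lpos rho unfolding a by (simp add: divide_simps power2_eq_square)
  moreover have "F y + \<epsilon> \<le> (F X + \<epsilon>) * exp (a * (sqn n y - sqn n X))" if "y \<in> ?C" for y
  proof -
    have "ln (F y + \<epsilon>) \<le> ln (F X + \<epsilon>) + a * (sqn n y - sqn n X)"
      using max[OF that] unfolding \<Psi>_def by (simp add: algebra_simps)
    then have "exp (ln (F y + \<epsilon>)) \<le> exp (ln (F X + \<epsilon>) + a * (sqn n y - sqn n X))" by simp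
    then show ?thesis using pos[OF that] pos[OF X] by (simp add: exp_add)
  qed
  ultimately show ?thesis using X by blast
qed

text \<open>The points are \<open>X\<close> and its shifts by \<open>\<eta>\<close> along each axis,
  both ways; \<open>u\<close> is the direction of \<open>X\<close>. If \<open>G\<close> were close
  to \<open>F\<close> at all of them, \<open>G\<close> would be bounded above slightly behind
  \<open>X\<close> as seen from \<open>\<beta>\<close>, and convexity on the line through
  \<open>X\<close> would make \<open>G \<beta>\<close> too large.\<close>

lemma detecting_points:
  fixes F :: "(nat \<Rightarrow> real) \<Rightarrow> real"
  assumes n: "0 < n" and D: "D \<subseteq> supp_below n"
    and ball: "\<And>y. y \<in> supp_below n \<Longrightarrow> sqn n y \<le> \<rho>\<^sup>2 \<Longrightarrow> y \<in> D"
    and cvx: "convex_on D F"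
    and cont: "continuous_on {y \<in> supp_below n. sqn n y \<le> (\<rho> / 2)\<^sup>2} F"
    and F0: "\<And>y. y \<in> D \<Longrightarrow> 0 \<le> F y" and osc: "\<And>y. y \<in> D \<Longrightarrow> F y \<le> F (\<lambda>_. 0) + 1"
    and e: "0 < \<epsilon>" and L: "ln (1 + 1 / \<epsilon>) \<le> L" "1 / 5 \<le> L" and rho: "0 < \<rho>" "\<rho> \<le> 1"
  shows "\<exists>u P. sqn n u = 1 \<and> finite P \<and> card P \<le> 2 * n + 1 \<and> P \<subseteq> D \<and>
    (\<forall>G. \<forall>\<beta>\<in>D. convex_on D G \<longrightarrow> sqn n \<beta> \<le> 1 \<longrightarrow> \<rho> \<le> dot n u \<beta> \<longrightarrow> G \<beta> < - (\<epsilon> / 2) \<longrightarrow>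
       (\<exists>p\<in>P. \<rho>\<^sup>2 / (30720 * L * real n) * max \<epsilon> (F p) < \<bar>F p - G p\<bar>))"
proof -
  \<comment> \<open>The maximum is taken over the ball of radius \<open>\<rho> / 2\<close>, so
    \<open>X\<close> has norm at most \<open>\<rho> / 4\<close> and a shift by
    \<open>\<eta> \<le> \<rho> / 4\<close> stays in that ball.\<close>
  define a where "a = 4 * L / (\<rho> / 2)\<^sup>2"
  have a: "0 < a" unfolding a_def using L rho by simp
  have a_eq: "a = 16 * L / \<rho>\<^sup>2" unfolding a_def by (simp add: power2_eq_square)
  have rho2: "(\<rho> / 2)\<^sup>2 \<le> \<rho>\<^sup>2" using rho by (simp add: power2_eq_square)
  have ball2: "y \<in> D" if "y \<in> supp_below n" "sqn n y \<le> (\<rho> / 2)\<^sup>2" for y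
    using that rho2 by (intro ball) auto
  obtain X where X: "X \<in> supp_below n" "sqn n X \<le> (\<rho> / 2 / 2)\<^sup>2"
    and bd: "\<And>y. y \<in> supp_below n \<Longrightarrow> sqn n y \<le> (\<rho> / 2)\<^sup>2 \<Longrightarrow>
       F y + \<epsilon> \<le> (F X + \<epsilon>) * exp (a * (sqn n y - sqn n X))"
    using log_quadratic_maximum[OF ball2 cont F0 osc e L(1) half_gt_zero[OF rho(1)] a_def] by blast
  have XD: "X \<in> D"
  proof (rule ball[OF X(1)])
    have "(\<rho> / 2 / 2)\<^sup>2 \<le> \<rho>\<^sup>2" using rho by (simp add: power2_eq_square)
    then show "sqn n X \<le> \<rho>\<^sup>2" using X(2) by linarith
  qed
  define r where "r = sqrt (sqn n X)"
  have r0: "0 \<le> r" unfolding r_def by simp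
  have r2: "r\<^sup>2 = sqn n X" unfolding r_def by simp
  have r: "r \<le> \<rho> / 4" unfolding r_def using X(2) rho by (intro real_le_lsqrt) auto
  have Xj: "\<bar>X j\<bar> \<le> r" if "j < n" for j
  proof -
    have "(X j)\<^sup>2 \<le> sqn n X" unfolding sqn_def using that by (intro member_le_sum) auto
    then show ?thesis unfolding r_def by (metis real_sqrt_abs real_sqrt_le_mono)
  qed
  define M where "M = F X + \<epsilon>"
  have M: "0 < M" "\<epsilon> \<le> M" unfolding M_def using e F0[OF XD] by auto
  \<comment> \<open>\<open>N\<close> bounds from below the gap at \<open>\<beta>\<close> between the
    affine function and \<open>G\<close>: \<open>M / 2\<close> comes from
    \<open>G \<beta> < - (\<epsilon> / 2)\<close>, and \<open>a * M * (r * \<rho>)\<close> from the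
    slope. All errors are measured in units of \<open>N\<close>.\<close>
  define N where "N = M * (1 / 2 + a * r * \<rho>)"
  have N: "M \<le> 2 * N" "0 < N" unfolding N_def using M a r0 rho by (auto intro!: mult_pos_pos add_pos_nonneg)
  define q where "q = sqrt (real n)"
  have q: "1 \<le> q" "q * q = real n" unfolding q_def using n by auto
  \<comment> \<open>This size yields \<open>6 * (a * \<eta>\<^sup>2) = \<theta> / 4\<close>.
    Together with \<open>10 * \<delta> = \<theta> / 2\<close> the errors add up to
    \<open>3 / 4 * \<theta>\<close>, less than the gap \<open>\<theta>\<close>, all in units of
    \<open>N\<close>.\<close>
  define \<eta> where "\<eta> = 1 / (48 * q * a)"
  have eta0: "0 < \<eta>" unfolding \<eta>_def using q a by simp
  have a_eta: "a * \<eta> = 1 / (48 * q)" unfolding \<eta>_def using a q by simp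
  have a_eta_le: "a * \<eta> \<le> 1 / 48" unfolding a_eta using q by (simp add: field_simps)
  have eta_le: "\<eta> \<le> \<rho> / 4"
  proof -
    have "\<eta> = (a * \<eta>) * \<rho>\<^sup>2 / (16 * L)" unfolding a_eq using L rho by simp
    also have "\<dots> \<le> (1 / 48) * \<rho>\<^sup>2 / (16 * (1 / 5))"
      using a_eta_le L by (intro frac_le mult_right_mono mult_nonneg_nonneg) auto
    also have "\<dots> \<le> \<rho> / 4" using rho by (simp add: power2_eq_square mult_left_le)
    finally show ?thesis .
  qed
  \<comment> \<open>The absolute coordinates of \<open>v = \<beta> - X\<close> sum to at most
    \<open>2 * q\<close>, so a step by \<open>- \<theta> * v\<close> stays in the cross-polytope of
    radius \<open>\<eta>\<close> about \<open>X\<close>.\<close>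
  define \<theta> where "\<theta> = \<eta> / (2 * q)"
  have th: "0 < \<theta>" "\<theta> \<le> 1" unfolding \<theta>_def using eta0 q eta_le rho by (auto simp: field_simps)
  define \<delta> where "\<delta> = \<rho>\<^sup>2 / (30720 * L * real n)"
  have delta: "\<delta> = \<theta> / 20"
    unfolding \<delta>_def \<theta>_def \<eta>_def a_eq q(2)[symmetric] using L rho q by (simp add: field_simps)
  have d0: "0 < \<delta>" unfolding delta using th by simp
  have a_eta2: "6 * (a * \<eta>\<^sup>2) = \<theta> / 4"
    using a_eta unfolding \<theta>_def power2_eq_square by (simp add: mult.assoc[symmetric])
  define pt where "pt \<sigma> j = (\<lambda>k. X k + (if k = j then \<sigma> * \<eta> else 0))" for \<sigma> :: real and j
  define P where "P = insert X ((\<lambda>(j, \<sigma>). pt \<sigma> j) ` ({..<n} \<times> {-1, 1}))"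
  \<comment> \<open>If \<open>X\<close> is the origin, the affine function is constant and any unit
    vector serves.\<close>
  define u where "u = (if r = 0 then (\<lambda>k. if k = 0 then 1 else 0) else (\<lambda>k. (1 / r) * X k))"
  have sqpt: "sqn n (pt \<sigma> j) - sqn n X = 2 * \<sigma> * \<eta> * X j + \<eta>\<^sup>2" if "j < n" "\<bar>\<sigma>\<bar> = 1" for \<sigma> j
  proof -
    have s: "\<sigma> * \<sigma> = 1" using that(2) by (metis abs_mult_self_eq mult_1)
    have "sqn n (pt \<sigma> j) = (\<Sum>k<n. (X k)\<^sup>2 + (if k = j then 2 * \<sigma> * \<eta> * X j + \<sigma> * \<sigma> * \<eta>\<^sup>2 else 0))"
      unfolding sqn_def pt_def by (rule sum.cong) (auto simp: power2_eq_square algebra_simps)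
    also have "\<dots> = sqn n X + (2 * \<sigma> * \<eta> * X j + \<eta>\<^sup>2)"
      using that(1) s by (simp add: sum.distrib sqn_def)
    finally show ?thesis by simp
  qed
  have pt_supp: "pt \<sigma> j \<in> supp_below n" if "j < n" for \<sigma> j
    using X(1) that unfolding pt_def supp_below_def by auto
  have prod_le: "\<bar>\<sigma> * X j\<bar> \<le> r" if "j < n" "\<bar>\<sigma>\<bar> = 1" for \<sigma> j
    using Xj[OF that(1)] that(2) by (simp add: abs_mult)
  have pt_ball: "sqn n (pt \<sigma> j) \<le> (\<rho> / 2)\<^sup>2" if "j < n" "\<bar>\<sigma>\<bar> = 1" for \<sigma> j
  proof -
    have "\<sigma> * X j \<le> r" using prod_le[OF that] by linarith
    then have "2 * \<eta> * (\<sigma> * X j) \<le> 2 * \<eta> * r" using eta0 by (intro mult_left_mono) auto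
    then have "sqn n (pt \<sigma> j) \<le> (r + \<eta>)\<^sup>2"
      using sqpt[OF that] r2 by (simp add: power2_eq_square algebra_simps)
    also have "\<dots> \<le> (\<rho> / 2)\<^sup>2" using r r0 eta_le eta0 by (intro power_mono) auto
    finally show ?thesis .
  qed
  have ptD: "pt \<sigma> j \<in> D" if "j < n" "\<bar>\<sigma>\<bar> = 1" for \<sigma> j
    using ball2 pt_supp pt_ball that by blast
  have F_pt: "F (pt \<sigma> j) + \<epsilon> \<le> 6 * N" "F (pt \<sigma> j) \<le> F X + 2 * a * M * (\<sigma> * \<eta> * X j) + 6 * (a * \<eta>\<^sup>2) * N"
    if js: "j < n" "\<bar>\<sigma>\<bar> = 1" for \<sigma> j
  proof -
    define \<xi> where "\<xi> = a * (2 * \<sigma> * \<eta> * X j + \<eta>\<^sup>2)"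
    have F1: "F (pt \<sigma> j) + \<epsilon> \<le> M * exp \<xi>"
      using bd[OF pt_supp[OF js(1)] pt_ball[OF js]] unfolding sqpt[OF js] M_def \<xi>_def .
    have "\<bar>a * \<eta> * (\<sigma> * X j)\<bar> \<le> a * \<eta> * r"
      using prod_le[OF js] a eta0 by (simp add: abs_mult)
    then have xi: "\<bar>\<xi>\<bar> \<le> 2 * (a * \<eta> * r) + a * \<eta> * \<eta>"
      using a eta0 unfolding \<xi>_def power2_eq_square by (simp add: algebra_simps abs_le_iff)
    have r1: "r \<le> 1" "\<eta> \<le> 1" using r eta_le rho by auto
    have small: "a * \<eta> * r \<le> 1 / 48 * 1" "a * \<eta> * \<eta> \<le> 1 / 48 * 1"
      using r1 r0 eta0 a by (intro mult_mono a_eta_le; simp)+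
    then have xi1: "\<bar>\<xi>\<bar> \<le> 1" using xi by linarith
    have "\<xi>\<^sup>2 \<le> (2 * (a * \<eta> * r) + a * \<eta> * \<eta>)\<^sup>2" using xi by (metis abs_ge_zero power2_abs power_mono)
    also have "\<dots> \<le> 8 * (a * \<eta> * r)\<^sup>2 + 2 * (a * \<eta> * \<eta>)\<^sup>2"
      using zero_le_power2[of "2 * (a * \<eta> * r) - a * \<eta> * \<eta>"] by (simp add: power2_eq_square algebra_simps)
    \<comment> \<open>One factor \<open>r\<close> is traded for \<open>\<rho> / 4\<close>, which
      leaves a multiple of \<open>a * \<eta>\<^sup>2\<close> times \<open>a * r * \<rho>\<close>.
      This is why \<open>N\<close> contains the summand with \<open>a * r * \<rho>\<close>.\<close>
    also have "8 * (a * \<eta> * r)\<^sup>2 = 8 * (a * \<eta>\<^sup>2) * (a * r) * r" by (simp add: power2_eq_square)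
    also have "\<dots> \<le> 8 * (a * \<eta>\<^sup>2) * (a * r) * (\<rho> / 4)" using r a r0 by (intro mult_left_mono) auto
    also have "2 * (a * \<eta> * \<eta>)\<^sup>2 = 2 * (a * \<eta>\<^sup>2) * (a * \<eta> * \<eta>)" by (simp add: power2_eq_square)
    also have "\<dots> \<le> 2 * (a * \<eta>\<^sup>2) * 1"
      using small(2) a by (intro mult_left_mono) auto
    finally have xi2: "\<xi>\<^sup>2 \<le> a * \<eta>\<^sup>2 * (2 * (a * r * \<rho>) + 2)" by (simp add: algebra_simps)
    have E: "exp \<xi> \<le> 1 + \<xi> + \<xi>\<^sup>2" by (rule exp_le_quadratic[OF xi1])
    have "\<xi>\<^sup>2 \<le> 1" using xi1 by (simp add: abs_square_le_1)
    then have "exp \<xi> \<le> 3" using E xi1 by linarith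
    then have "M * exp \<xi> \<le> M * 3" using M by (intro mult_left_mono) auto
    then show "F (pt \<sigma> j) + \<epsilon> \<le> 6 * N" using F1 N by linarith
    have "exp \<xi> \<le> 1 + 2 * a * (\<sigma> * \<eta> * X j) + 6 * (a * \<eta>\<^sup>2) * (1 / 2 + a * r * \<rho>)"
    proof -
      have "0 \<le> a * \<eta>\<^sup>2 * (4 * (a * r * \<rho>))" using a r0 rho by simp
      then show ?thesis using E xi2 unfolding \<xi>_def by (simp add: algebra_simps)
    qed
    then have MX: "M * exp \<xi> \<le> M * (1 + 2 * a * (\<sigma> * \<eta> * X j) + 6 * (a * \<eta>\<^sup>2) * (1 / 2 + a * r * \<rho>))"
      using M by (intro mult_left_mono) auto
    then show "F (pt \<sigma> j) \<le> F X + 2 * a * M * (\<sigma> * \<eta> * X j) + 6 * (a * \<eta>\<^sup>2) * N"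
    proof -
      have "M * (1 + 2 * a * (\<sigma> * \<eta> * X j) + 6 * (a * \<eta>\<^sup>2) * (1 / 2 + a * r * \<rho>))
        = M + 2 * a * M * (\<sigma> * \<eta> * X j) + 6 * (a * \<eta>\<^sup>2) * N"
        unfolding N_def by (simp only: ring_distribs mult_1_right) (simp only: mult_ac)
      then show ?thesis using F1 MX unfolding M_def by linarith
    qed
  qed
  show ?thesis
  proof (intro exI[of _ u] exI[of _ P] conjI allI ballI impI)
    show "sqn n u = 1"
    proof (cases "r = 0")
      case True
      then show ?thesis unfolding u_def sqn_def using n
        by (simp add: if_distrib[of "\<lambda>x. x\<^sup>2"] cong: if_cong)
    next
      case False
      then show ?thesis unfolding u_def by (simp only: if_False sqn_scale) (simp add: r2[symmetric] power_divide)
    qed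
    show "finite P" unfolding P_def by simp
    have "card ((\<lambda>(j, \<sigma>). pt \<sigma> j) ` ({..<n} \<times> {-1, 1})) \<le> card ({..<n} \<times> {-1, 1 :: real})"
      by (rule card_image_le) simp
    then have "card ((\<lambda>(j, \<sigma>). pt \<sigma> j) ` ({..<n} \<times> {-1, 1})) \<le> 2 * n"
      by (simp add: card_cartesian_product)
    then show "card P \<le> 2 * n + 1"
      unfolding P_def by (simp add: card_insert_if)
    show "P \<subseteq> D" unfolding P_def using XD ptD by auto
  next
    fix G \<beta>
    assume \<beta>0: "\<beta> \<in> D" and G: "convex_on D G" and \<beta>1: "sqn n \<beta> \<le> 1" "\<rho> \<le> dot n u \<beta>" and Gb: "G \<beta> < - (\<epsilon> / 2)"
    note \<beta> = \<beta>0 \<beta>1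
    show "\<exists>p\<in>P. \<rho>\<^sup>2 / (30720 * L * real n) * max \<epsilon> (F p) < \<bar>F p - G p\<bar>"
    proof (rule ccontr)
      assume "\<not> ?thesis"
      then have close: "\<bar>F p - G p\<bar> \<le> \<delta> * max \<epsilon> (F p)" if "p \<in> P" for p
        using that unfolding \<delta>_def by (auto simp: not_less)
      have close': "\<bar>F p - G p\<bar> \<le> \<delta> * (F p + \<epsilon>)" if "p \<in> P" "p \<in> D" for p
      proof -
        have "max \<epsilon> (F p) \<le> F p + \<epsilon>" using F0[OF that(2)] e by simp
        then have "\<delta> * max \<epsilon> (F p) \<le> \<delta> * (F p + \<epsilon>)" using d0 by (intro mult_left_mono) auto
        then show ?thesis using close[OF that(1)] by linarith
      qed
      define v where "v k = \<beta> k - X k" for k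
      have dXb: "r * \<rho> \<le> dot n X \<beta>"
      proof (cases "r = 0")
        case True
        then have "\<bar>dot n X \<beta>\<bar> \<le> 0" using dot_le_sqrt[of n X \<beta>] unfolding r_def by simp
        then show ?thesis using True by simp
      next
        case False
        then have "dot n X \<beta> = r * dot n u \<beta>" unfolding u_def dot_def by (simp add: sum_distrib_left mult.assoc)
        then show ?thesis using \<beta>(3) r0 by (simp add: mult_left_mono)
      qed
      define b where "b = dot n X v"
      have b: "b = dot n X \<beta> - r\<^sup>2"
        unfolding b_def v_def r2 dot_self[symmetric] unfolding dot_def by (simp add: algebra_simps sum_subtractf)
      have b_ge: "r * \<rho> \<le> 2 * b"
      proof -
        have "r * r \<le> r * (\<rho> / 4)" using r r0 by (intro mult_left_mono) auto
        moreover have "0 \<le> r * \<rho>" using r0 rho by simp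
        ultimately show ?thesis using b dXb unfolding power2_eq_square by linarith
      qed
      have gap: "N < F X + 2 * a * M * b - G \<beta>"
      proof -
        have "a * M * (r * \<rho>) \<le> a * M * (2 * b)" using a M b_ge by (intro mult_left_mono) auto
        moreover have "N = M / 2 + a * M * (r * \<rho>)" unfolding N_def by (simp add: algebra_simps)
        moreover have "M / 2 \<le> F X + \<epsilon> / 2" using F0[OF XD] unfolding M_def by (simp add: field_simps)
        ultimately show ?thesis using Gb by simp
      qed
      have S: "(\<Sum>j<n. \<bar>v j\<bar>) \<le> 2 * q"
      proof -
        have v_eq: "v = (\<lambda>i. \<beta> i + (- X i))" unfolding v_def by auto
        have "sqrt (sqn n v) \<le> sqrt (sqn n \<beta>) + sqrt (sqn n (\<lambda>i. - X i))"
          unfolding v_eq by (rule sqrt_sqn_triangle)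
        also have "\<dots> \<le> 1 + 1"
        proof (rule add_mono)
          show "sqrt (sqn n \<beta>) \<le> 1" using \<beta>(2) by simp
          have "sqn n (\<lambda>i. - X i) = sqn n X" by (simp add: sqn_def)
          moreover have "sqrt (sqn n X) \<le> 1" using r rho unfolding r_def by linarith
          ultimately show "sqrt (sqn n (\<lambda>i. - X i)) \<le> 1" by simp
        qed
        finally have "sqrt (sqn n v) \<le> 2" by simp
        then have "sqn n v \<le> 4" using sqrt_le_D[of "sqn n v" 2] by simp
        then have "(\<Sum>j<n. \<bar>v j\<bar>)\<^sup>2 \<le> real n * 4"
          using sum_abs_le_sqn[of v n] by (meson mult_left_mono of_nat_0_le_iff order_trans)
        also have "\<dots> = (2 * q)\<^sup>2" using q by (simp add: power2_eq_square)
        finally show ?thesis by (rule power2_le_imp_le) (use q in simp)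
      qed
      \<comment> \<open>The weights express \<open>z = X - \<theta> * v\<close> as a convex
        combination of the shifted points, each shift having sign opposite to \<open>v j\<close>.
        The remaining weight \<open>1 - \<Lambda>\<close> goes to \<open>X\<close>, under index
        \<open>n\<close> in \<open>w\<close> and \<open>Y\<close>.\<close>
      define l where "l j = \<bar>v j\<bar> / (2 * q)" for j
      define \<Lambda> where "\<Lambda> = (\<Sum>j<n. l j)"
      have l0: "0 \<le> l j" for j unfolding l_def using q by simp
      have Lam: "\<Lambda> \<le> 1" unfolding \<Lambda>_def l_def sum_divide_distrib[symmetric] using S q by (simp add: pos_divide_le_eq)
      define sg where "sg j = (if v j \<le> 0 then 1 else - 1 :: real)" for j
      have sg: "\<bar>sg j\<bar> = 1" for j unfolding sg_def by simp
      have lsg: "l j * (sg j * \<eta>) = - \<theta> * v j" for j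
        unfolding l_def sg_def \<theta>_def using q by auto
      define z where "z k = X k - \<theta> * v k" for k
      define E where "E = 6 * (a * \<eta>\<^sup>2) * N + 6 * \<delta> * N"
      have GX: "\<bar>F X - G X\<bar> \<le> 2 * \<delta> * N"
      proof -
        have "\<bar>F X - G X\<bar> \<le> \<delta> * M" using close'[OF _ XD] unfolding P_def M_def by auto
        also have "\<dots> \<le> \<delta> * (2 * N)" using N d0 by (intro mult_left_mono) auto
        finally show ?thesis by simp
      qed
      have GX': "G X \<le> F X + E"
      proof -
        have "0 \<le> 6 * (a * \<eta>\<^sup>2) * N" "0 \<le> \<delta> * N" using a N d0 by auto
        then show ?thesis using GX unfolding E_def by (simp only: mult.assoc)
      qed
      have Gpt: "G (pt (sg j) j) \<le> F X + 2 * a * M * (sg j * \<eta> * X j) + E" if j: "j < n" for j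
      proof -
        have "sg j \<in> {-1, 1}" unfolding sg_def by auto
        then have inP: "pt (sg j) j \<in> P" using j unfolding P_def by force
        have "\<bar>F (pt (sg j) j) - G (pt (sg j) j)\<bar> \<le> \<delta> * (F (pt (sg j) j) + \<epsilon>)"
          by (rule close'[OF inP ptD[OF j sg]])
        also have "\<dots> \<le> \<delta> * (6 * N)" using F_pt(1)[OF j sg] d0 by (intro mult_left_mono) auto
        finally show ?thesis using F_pt(2)[OF j sg[of j]] unfolding E_def abs_le_iff by (simp add: algebra_simps)
      qed
      define w where "w i = (if i < n then l i else 1 - \<Lambda>)" for i
      define Y where "Y i = (if i < n then pt (sg i) i else X)" for i
      have z_eq: "z = (\<Sum>i<Suc n. w i *\<^sub>R Y i)"
      proof
        fix k
        have "(\<Sum>i<Suc n. w i *\<^sub>R Y i) k = (\<Sum>i<n. l i * pt (sg i) i k) + (1 - \<Lambda>) * X k"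
          unfolding sum_fun_apply w_def Y_def by simp
        also have "(\<Sum>i<n. l i * pt (sg i) i k) = (\<Sum>i<n. l i * X k) + (\<Sum>i<n. if k = i then l i * (sg i * \<eta>) else 0)"
          unfolding sum.distrib[symmetric] pt_def by (rule sum.cong) (auto simp: algebra_simps)
        also have "(\<Sum>i<n. l i * X k) = \<Lambda> * X k" unfolding \<Lambda>_def sum_distrib_right ..
        also have "(\<Sum>i<n. if k = i then l i * (sg i * \<eta>) else 0) = (if k < n then - \<theta> * v k else 0)"
          by (simp add: lsg)
        also have "\<dots> = - \<theta> * v k" using X(1) \<beta>(1) D unfolding supp_below_def v_def by auto
        finally have "(\<Sum>i<Suc n. w i *\<^sub>R Y i) k = \<Lambda> * X k + - \<theta> * v k + (1 - \<Lambda>) * X k" .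
        moreover have "\<Lambda> * X k + - \<theta> * v k + (1 - \<Lambda>) * X k = z k"
          unfolding z_def by (simp add: algebra_simps)
        ultimately show "z k = (\<Sum>i<Suc n. w i *\<^sub>R Y i) k" by (simp only:)
      qed
      have cD: "convex D" using cvx unfolding convex_on_def by simp
      have sw: "(\<Sum>i<Suc n. w i) = 1" unfolding w_def \<Lambda>_def by simp
      have w0: "0 \<le> w i" for i unfolding w_def using l0 Lam by auto
      have YD: "Y i \<in> D" for i unfolding Y_def using XD ptD sg by auto
      have zD: "z \<in> D" unfolding z_eq
        by (rule convex_sum) (use cD sw w0 YD in auto)
      have "G z \<le> (\<Sum>i<Suc n. w i * G (Y i))" unfolding z_eq
        by (rule convex_on_sum[OF _ _ G]) (use sw w0 YD in auto)
      also have "\<dots> = (\<Sum>i<n. l i * G (pt (sg i) i)) + (1 - \<Lambda>) * G X"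
        unfolding w_def Y_def by simp
      also have "\<dots> \<le> (\<Sum>i<n. l i * (F X + 2 * a * M * (sg i * \<eta> * X i) + E)) + (1 - \<Lambda>) * (F X + E)"
        using Gpt GX' l0 Lam by (intro add_mono sum_mono mult_left_mono) auto
      also have "(\<Sum>i<n. l i * (F X + 2 * a * M * (sg i * \<eta> * X i) + E))
         = (\<Sum>i<n. l i * (F X + E) - 2 * a * M * \<theta> * (X i * v i))"
      proof (rule sum.cong[OF refl])
        fix i
        have "l i * (F X + 2 * a * M * (sg i * \<eta> * X i) + E) = l i * (F X + E) + 2 * a * M * X i * (l i * (sg i * \<eta>))"
          by (simp add: algebra_simps)
        then show "l i * (F X + 2 * a * M * (sg i * \<eta> * X i) + E) = l i * (F X + E) - 2 * a * M * \<theta> * (X i * v i)"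
          unfolding lsg by (simp add: algebra_simps)
      qed
      also have "\<dots> = \<Lambda> * (F X + E) - 2 * a * M * \<theta> * b"
        unfolding sum_subtractf \<Lambda>_def sum_distrib_right b_def dot_def sum_distrib_left ..
      finally have Gz: "G z \<le> F X + E - \<theta> * (2 * a * M * b)" by (simp add: algebra_simps)
      \<comment> \<open>\<open>X\<close> lies on the segment from \<open>z\<close> to
        \<open>\<beta>\<close>, with \<open>(1 + \<theta>) * X = z + \<theta> * \<beta>\<close> in
        each coordinate.\<close>
      have "(1 + \<theta>) * G X \<le> G z + \<theta> * G \<beta>"
        by (rule convex_on_ratio[OF G zD \<beta>(1)]) (use th in \<open>auto simp: z_def v_def algebra_simps\<close>)
      moreover have "(1 + \<theta>) * (F X - 2 * \<delta> * N) \<le> (1 + \<theta>) * G X"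
        using GX th by (intro mult_left_mono) auto
      ultimately have "\<theta> * (F X + 2 * a * M * b - G \<beta>) \<le> E + (1 + \<theta>) * (2 * \<delta> * N)"
        using Gz by (simp add: algebra_simps)
      moreover have "\<theta> * N < \<theta> * (F X + 2 * a * M * b - G \<beta>)" using gap th by simp
      moreover have "(1 + \<theta>) * (2 * \<delta> * N) \<le> 2 * (2 * \<delta> * N)" using th d0 N by (intro mult_right_mono) auto
      ultimately have "\<theta> * N < (6 * (a * \<eta>\<^sup>2) + 10 * \<delta>) * N" unfolding E_def by (simp add: algebra_simps)
      also have "6 * (a * \<eta>\<^sup>2) + 10 * \<delta> = 3 / 4 * \<theta>" unfolding a_eta2 delta by simp
      finally show False using th N by simp
    qed
  qed
qed

section \<open>An ellipsoid of nearly optimal weight and volume\<close>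

definition ell :: "nat \<Rightarrow> (nat \<Rightarrow> real) \<Rightarrow> (nat \<Rightarrow> nat \<Rightarrow> real) \<Rightarrow> (nat \<Rightarrow> real) set" where
  "ell n c V = emap n c V ` {y. sqn n y \<le> 1}"

text \<open>A near-maximizer of weight minus \<open>\<kappa>\<close> times log-volume works: if a
  cap were reached by weight less than \<open>q\<close>, cutting it off would lose less than
  \<open>q\<close> and gain \<open>2 * q\<close>, more than near-maximality allows.\<close>

lemma deep_ellipsoid:
  fixes w :: "'i \<Rightarrow> real" and S :: "'i \<Rightarrow> (nat \<Rightarrow> real) set"
  assumes n: "0 < n" and I: "finite I" and w0: "\<And>i. i \<in> I \<Longrightarrow> 0 \<le> w i" and w1: "(\<Sum>i\<in>I. w i) = 1"
    and E0: "detf n V0 \<noteq> 0" "\<And>i. i \<in> I \<Longrightarrow> S i \<subseteq> ell n c0 V0"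
    and lower: "\<And>c V i. i \<in> I \<Longrightarrow> S i \<subseteq> ell n c V \<Longrightarrow> lb \<le> ln \<bar>detf n V\<bar>"
    and Lam: "ln \<bar>detf n V0\<bar> - lb \<le> \<Lambda>" "1 \<le> \<Lambda>"
  shows "\<exists>c V. detf n V \<noteq> 0 \<and> (\<forall>u. sqn n u = 1 \<longrightarrow>
    1 / (64 * real n * \<Lambda>) \<le> sum w {i \<in> I. S i \<subseteq> ell n c V \<and>
       (\<exists>y. sqn n y \<le> 1 \<and> emap n c V y \<in> S i \<and> 1 / (8 * real n) < dot n u y)})"
proof -
  define wt where "wt c V = sum w {i \<in> I. S i \<subseteq> ell n c V}" for c V
  \<comment> \<open>The whole range \<open>\<Lambda>\<close> of log-volumes is worth only 1/2, so
    comparison with the initial ellipsoid, of weight 1, leaves weight above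
    \<open>1 / 2 - q\<close>.\<close>
  define \<kappa> where "\<kappa> = 1 / (2 * \<Lambda>)"
  \<comment> \<open>Half of the gain \<open>\<kappa> / (16 * n)\<close> of a single cut.\<close>
  define q where "q = 1 / (64 * real n * \<Lambda>)"
  have kap: "0 < \<kappa>" "\<kappa> * \<Lambda> = 1 / 2" unfolding \<kappa>_def using Lam by auto
  have q_kap: "q = \<kappa> / (32 * real n)" unfolding q_def \<kappa>_def by simp
  have q: "0 < q" "q \<le> 1 / 64"
  proof -
    show "0 < q" unfolding q_def using n Lam by simp
    have "1 \<le> real n * \<Lambda>" using n Lam mult_mono[of 1 "real n" 1 \<Lambda>] by simp
    then show "q \<le> 1 / 64" unfolding q_def by (simp add: field_simps)
  qed
  \<comment> \<open>A volume bound is known only for ellipsoids containing some \<open>S i\<close>;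
    positive weight guarantees one, so the objective is bounded above on \<open>A\<close>. Cut
    ellipsoids stay in \<open>A\<close> because their weight exceeds
    \<open>1 / 2 - 2 * q\<close>.\<close>
  define A where "A = {(c, V). detf n V \<noteq> 0 \<and> 0 < wt c V}"
  define \<Phi> where "\<Phi> = (\<lambda>(c, V). wt c V - \<kappa> * ln \<bar>detf n V\<bar>)"
  have wt_le: "wt c V \<le> 1" for c V
    unfolding wt_def w1[symmetric] using I w0 by (intro sum_mono2) auto
  have lbA: "lb \<le> ln \<bar>detf n V\<bar>" if "0 < wt c V" for c V
  proof -
    have "{i \<in> I. S i \<subseteq> ell n c V} \<noteq> {}" using that unfolding wt_def by (metis less_irrefl sum.empty)
    then show ?thesis using lower by blast
  qed
  have upper: "\<Phi> x \<le> 1 - \<kappa> * lb" if "x \<in> A" for x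
  proof -
    obtain c V where x: "x = (c, V)" by (cases x)
    have "\<kappa> * lb \<le> \<kappa> * ln \<bar>detf n V\<bar>"
      using lbA[of c V] kap that unfolding A_def x by (intro mult_left_mono) auto
    then show ?thesis using wt_le[of c V] unfolding \<Phi>_def x by simp
  qed
  have wtE0: "wt c0 V0 = 1"
  proof -
    have "{i \<in> I. S i \<subseteq> ell n c0 V0} = I" using E0 by blast
    then show ?thesis unfolding wt_def w1[symmetric] by simp
  qed
  have inA: "(c0, V0) \<in> A" unfolding A_def using E0(1) wtE0 by simp
  have bdd: "bdd_above (\<Phi> ` A)" using upper by (intro bdd_aboveI2) auto
  have "Sup (\<Phi> ` A) - q < Sup (\<Phi> ` A)" using q by simp
  then obtain x where xA: "x \<in> A" and x_near: "Sup (\<Phi> ` A) - q < \<Phi> x"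
    using less_cSup_iff[OF _ bdd] inA by blast
  obtain c V where x: "x = (c, V)" by (cases x)
  have dV: "detf n V \<noteq> 0" and wpos: "0 < wt c V" using xA unfolding A_def x by auto
  have "\<Phi> (c0, V0) \<le> Sup (\<Phi> ` A)" using inA bdd by (intro cSup_upper) auto
  then have "1 - \<kappa> * ln \<bar>detf n V0\<bar> - q < wt c V - \<kappa> * ln \<bar>detf n V\<bar>"
    using x_near unfolding \<Phi>_def x by (simp add: wtE0)
  moreover have "\<kappa> * (ln \<bar>detf n V0\<bar> - ln \<bar>detf n V\<bar>) \<le> \<kappa> * \<Lambda>"
    using lbA[OF wpos] Lam kap by (intro mult_left_mono) auto
  ultimately have half: "1 / 2 - q < wt c V" using kap(2) by (simp add: algebra_simps)
  show ?thesis
  proof (intro exI[of _ c] exI[of _ V] conjI allI impI)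
    show "detf n V \<noteq> 0" by (rule dV)
    fix u assume u: "sqn n u = 1"
    define J where "J = {i \<in> I. S i \<subseteq> ell n c V \<and>
       (\<exists>y. sqn n y \<le> 1 \<and> emap n c V y \<in> S i \<and> 1 / (8 * real n) < dot n u y)}"
    have "q \<le> sum w J"
    proof (rule ccontr)
      assume "\<not> q \<le> sum w J"
      then have Jq: "sum w J < q" by simp
      obtain c' V' where V': "detf n V' \<noteq> 0" "ln \<bar>detf n V'\<bar> \<le> ln \<bar>detf n V\<bar> - 1 / (16 * real n)"
        and cover: "\<And>y. sqn n y \<le> 1 \<Longrightarrow> dot n u y \<le> 1 / (8 * real n) \<Longrightarrow>
           \<exists>y'. sqn n y' \<le> 1 \<and> emap n c V y = emap n c' V' y'"
        by (rule ellipsoid_cut[OF n u dV]) (rule that)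
      \<comment> \<open>A set \<open>S i\<close> that lies in the ellipsoid without reaching past
        the cut is covered by the new ellipsoid.\<close>
      have sub: "{i \<in> I. S i \<subseteq> ell n c V} - J \<subseteq> {i \<in> I. S i \<subseteq> ell n c' V'}"
      proof
        fix i assume i: "i \<in> {i \<in> I. S i \<subseteq> ell n c V} - J"
        have "z \<in> ell n c' V'" if z: "z \<in> S i" for z
        proof -
          obtain y where y: "sqn n y \<le> 1" "z = emap n c V y" using i z unfolding ell_def by blast
          have "dot n u y \<le> 1 / (8 * real n)" using i y z unfolding J_def by (auto simp: not_less)
          then show ?thesis using cover[OF y(1)] y(2) unfolding ell_def by auto
        qed
        then show "i \<in> {i \<in> I. S i \<subseteq> ell n c' V'}" using i by blast
      qed
      have "wt c V - sum w J \<le> sum w ({i \<in> I. S i \<subseteq> ell n c V} - J)"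
      proof -
        have "J \<subseteq> {i \<in> I. S i \<subseteq> ell n c V}" unfolding J_def by auto
        then show ?thesis unfolding wt_def using I by (simp add: sum_diff)
      qed
      also have "\<dots> \<le> wt c' V'" unfolding wt_def using sub I w0 by (intro sum_mono2) auto
      finally have wt': "wt c V - q < wt c' V'" using Jq by simp
      then have "(c', V') \<in> A" unfolding A_def using half q V'(1) by simp
      then have "\<Phi> (c', V') \<le> Sup (\<Phi> ` A)" using bdd by (intro cSup_upper) auto
      then have "wt c' V' - \<kappa> * ln \<bar>detf n V'\<bar> < wt c V - \<kappa> * ln \<bar>detf n V\<bar> + q"
        using x_near unfolding x \<Phi>_def by simp
      moreover have "\<kappa> * ln \<bar>detf n V'\<bar> \<le> \<kappa> * (ln \<bar>detf n V\<bar> - 1 / (16 * real n))"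
        using V'(2) kap by (intro mult_left_mono) auto
      moreover have "\<kappa> * (ln \<bar>detf n V\<bar> - 1 / (16 * real n)) = \<kappa> * ln \<bar>detf n V\<bar> - 2 * q"
        unfolding q_kap by (simp add: algebra_simps)
      ultimately show False using wt' by linarith
    qed
    then show "1 / (64 * real n * \<Lambda>) \<le> sum w {i \<in> I. S i \<subseteq> ell n c V \<and>
       (\<exists>y. sqn n y \<le> 1 \<and> emap n c V y \<in> S i \<and> 1 / (8 * real n) < dot n u y)}"
      unfolding q_def J_def .
  qed
qed

section \<open>Volume bounds, large simplices and separation\<close>

lemma detf_scale: "detf n (\<lambda>i k. t * V i k) = t ^ n * detf n V"
proof -
  have "detf n (\<lambda>i k. t * V i k) = detf n (\<lambda>i k. \<Sum>j<n. (if i = j then t else 0) * V j k)"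
    by (rule detf_cong) (simp add: if_distrib[of "\<lambda>x. x * _"] cong: if_cong)
  then show ?thesis by (simp add: detf_mult detf_diag)
qed

lemma abs_coord_le_sqn: "\<bar>y j\<bar> \<le> sqrt (sqn n y)" if "j < n"
proof -
  have "(y j)\<^sup>2 \<le> sqn n y" unfolding sqn_def using that by (intro member_le_sum) auto
  then show ?thesis by (metis real_sqrt_abs real_sqrt_le_mono)
qed

text \<open>In ball coordinates two points of the ellipsoid differ by at most 2 in each entry. The
  edge vectors of the scaled simplex thus form an array of determinant at most
  \<open>(2 * n) ^ n\<close>, multiplied by \<open>V\<close>.\<close>

lemma det_lower_bound:
  assumes b: "b \<in> ell n c V" and bv: "\<And>j. j < n \<Longrightarrow> (\<lambda>k. b k + \<tau> * v j k) \<in> ell n c V"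
    and t: "0 \<le> \<tau>"
  shows "\<tau> ^ n * \<bar>detf n v\<bar> \<le> (2 * real n) ^ n * \<bar>detf n V\<bar>"
proof -
  obtain y0 where y0: "sqn n y0 \<le> 1" "b = emap n c V y0" using b unfolding ell_def by auto
  have "\<forall>j. \<exists>y. j < n \<longrightarrow> sqn n y \<le> 1 \<and> (\<lambda>k. b k + \<tau> * v j k) = emap n c V y"
    using bv unfolding ell_def by blast
  then obtain Y where Y: "\<And>j. j < n \<Longrightarrow> sqn n (Y j) \<le> 1"
    "\<And>j. j < n \<Longrightarrow> (\<lambda>k. b k + \<tau> * v j k) = emap n c V (Y j)" by metis
  define B where "B j i = Y j i - y0 i" for j i
  have "\<tau> * v j k = (\<Sum>i<n. B j i * V i k)" if "j < n" "k < n" for j k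
  proof -
    have "b k + \<tau> * v j k = emap n c V (Y j) k" using fun_cong[OF Y(2)[OF that(1)], of k] by simp
    then show ?thesis using that(2) unfolding y0(2) emap_def B_def
      by (simp add: left_diff_distrib sum_subtractf)
  qed
  then have "detf n (\<lambda>j k. \<tau> * v j k) = detf n (\<lambda>j k. \<Sum>i<n. B j i * V i k)"
    by (intro detf_cong)
  then have eq: "\<tau> ^ n * detf n v = detf n B * detf n V" by (simp only: detf_scale detf_mult)
  have c1: "\<bar>y i\<bar> \<le> 1" if "sqn n y \<le> 1" "i < n" for y i
    using abs_coord_le_sqn[OF that(2), of y] that(1) by (meson order_trans real_sqrt_le_1_iff)
  have "\<bar>detf n B\<bar> \<le> (real n * 2) ^ n"
  proof (rule detf_bound)
    fix j i assume "j < n" "i < n"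
    then show "\<bar>B j i\<bar> \<le> 2" unfolding B_def using c1[OF y0(1)] c1[OF Y(1)] abs_triangle_ineq4[of "Y j i" "y0 i"]
      by fastforce
  qed simp
  then have "\<bar>detf n B\<bar> * \<bar>detf n V\<bar> \<le> (2 * real n) ^ n * \<bar>detf n V\<bar>"
    by (intro mult_right_mono) (auto simp: mult.commute)
  then show ?thesis using arg_cong[OF eq, of abs] t by (simp add: abs_mult)
qed

text \<open>Among the simplices in \<open>K\<close> with vertex \<open>p\<close>, one has a
  determinant within a factor 2 of the supremum. Replacing its edge \<open>v k\<close> by
  \<open>x - p\<close> multiplies the determinant by \<open>y k\<close>, so
  \<open>\<bar>y k\<bar>\<close> is at most 2.\<close>

lemma large_simplex:
  assumes K: "K \<subseteq> supp_below n" and bdd: "\<And>x y k. x \<in> K \<Longrightarrow> y \<in> K \<Longrightarrow> \<bar>x k - y k\<bar> \<le> 1"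
    and p: "p \<in> K" and r: "0 < r" "\<And>j. j < n \<Longrightarrow> (\<lambda>k. p k + (if k = j then r else 0)) \<in> K"
  shows "\<exists>v. detf n v \<noteq> 0 \<and> (\<forall>j<n. (\<lambda>k. p k + v j k) \<in> K) \<and>
    (\<forall>x\<in>K. \<exists>y. (\<forall>j<n. \<bar>y j\<bar> \<le> 2) \<and> x = emap n p v y)"
proof -
  define T where "T = {v. \<forall>j<n. (\<lambda>k. p k + v j k) \<in> K}"
  define d where "d v = \<bar>detf n v\<bar>" for v
  have "d v \<le> (real n * 1) ^ n" if v: "v \<in> T" for v
    unfolding d_def
  proof (rule detf_bound)
    fix i j assume "i < n" "j < n"
    then show "\<bar>v i j\<bar> \<le> 1" using bdd[OF _ p, of "\<lambda>k. p k + v i k" j] v unfolding T_def by simp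
  qed simp
  then have bd: "bdd_above (d ` T)" by (intro bdd_aboveI2) auto
  \<comment> \<open>The axis-parallel simplex of side \<open>r\<close> makes the supremum positive,
    so the simplex chosen below is nondegenerate.\<close>
  define v0 where "v0 j k = (if j = k then r else 0)" for j k :: nat
  have v0: "v0 \<in> T" unfolding T_def v0_def using r(2) by (simp add: eq_commute)
  have "d v0 = r ^ n" unfolding d_def v0_def using detf_diag[of n "\<lambda>_. r"] r by simp
  then have pos: "0 < Sup (d ` T)" using cSup_upper[OF imageI[OF v0] bd] r(1)
    by (metis less_le_trans zero_less_power)
  then have "Sup (d ` T) / 2 < Sup (d ` T)" by simp
  then obtain v where v: "v \<in> T" "Sup (d ` T) / 2 < d v"
    using less_cSup_iff[OF _ bd] v0 by blast
  have dv: "detf n v \<noteq> 0" using v(2) pos unfolding d_def by auto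
  moreover have "\<exists>y. (\<forall>j<n. \<bar>y j\<bar> \<le> 2) \<and> x = emap n p v y" if x: "x \<in> K" for x
  proof -
    define z where "z k = x k - p k" for k
    obtain y where y: "\<forall>i<n. z i = (\<Sum>j<n. y j * v j i)" using detf_solve[OF dv] by blast
    have "\<bar>y k\<bar> \<le> 2" if k: "k < n" for k
    proof -
      have "(\<lambda>i. p i + z i) = x" unfolding z_def by simp
      then have "v(k := z) \<in> T" using v(1) x unfolding T_def by auto
      then have "d (v(k := z)) \<le> Sup (d ` T)" using bd by (intro cSup_upper) auto
      also have "\<dots> \<le> 2 * d v" using v(2) by simp
      finally have "\<bar>y k\<bar> * d v \<le> 2 * d v"
        using detf_cramer[OF k, of z y v] y unfolding d_def by (simp add: abs_mult)
      then show ?thesis using v(2) pos by (simp add: mult_le_cancel_right)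
    qed
    moreover have "x = emap n p v y"
    proof
      fix k show "x k = emap n p v y k"
      proof (cases "k < n")
        case True
        then have "x k - p k = (\<Sum>j<n. y j * v j k)" using y unfolding z_def by simp
        then show ?thesis using True unfolding emap_def by simp
      next
        case False then show ?thesis using K x unfolding emap_def supp_below_def by auto
      qed
    qed
    ultimately show ?thesis by blast
  qed
  ultimately show ?thesis using v(1) unfolding T_def by blast
qed

text \<open>\<open>h\<close> points from the nearest point \<open>x0\<close> of \<open>K\<close>, in
  the Euclidean norm, to \<open>p\<close>. Moving from \<open>x0\<close> towards any
  \<open>x\<close> in \<open>K\<close> cannot reduce the distance, and the first-order term of this
  gives the sign.\<close>

lemma separating_functional:
  assumes K: "K \<subseteq> supp_below n" "compact K" "convex K" "K \<noteq> {}" and p: "p \<in> supp_below n" "p \<notin> K"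
  shows "\<exists>h. \<forall>x\<in>K. dot n h x < dot n h p"
proof -
  have cont: "continuous_on K (\<lambda>x. sqn n (\<lambda>k. x k - p k))"
    unfolding sqn_def by (intro continuous_intros)
  obtain x0 where x0: "x0 \<in> K" "\<And>x. x \<in> K \<Longrightarrow> sqn n (\<lambda>k. x0 k - p k) \<le> sqn n (\<lambda>k. x k - p k)"
    using continuous_attains_inf[OF K(2,4) cont] by blast
  define h where "h k = p k - x0 k" for k
  have sym: "sqn n (\<lambda>k. x k - p k) = sqn n (\<lambda>k. p k - x k)" for x
    unfolding sqn_def by (simp add: power2_commute)
  have hpos: "0 < sqn n h"
  proof (rule ccontr)
    assume "\<not> 0 < sqn n h"
    then have "sqn n h = 0" using sqn_nonneg[of n h] by linarith
    then have "\<forall>k<n. h k = 0" unfolding sqn_def by (subst (asm) sum_nonneg_eq_0_iff) auto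
    then have "p k = x0 k" for k
      using p(1) K(1) x0(1) unfolding h_def supp_below_def by (cases "k < n") auto
    then have "p = x0" by (rule ext)
    then show False using p(2) x0(1) by simp
  qed
  have "dot n h x < dot n h p" if x: "x \<in> K" for x
  proof -
    define d where "d k = x0 k - x k" for k
    have step: "0 \<le> 2 * dot n h d + t * sqn n d" if t: "0 < t" "t \<le> 1" for t
    proof -
      have "(1 - t) *\<^sub>R x0 + t *\<^sub>R x \<in> K" using K(3) x0(1) x t unfolding convex_alt by auto
      then have "sqn n h \<le> sqn n (\<lambda>k. p k - ((1 - t) *\<^sub>R x0 + t *\<^sub>R x) k)"
        using x0(2) unfolding sym h_def by blast
      also have "(\<lambda>k. p k - ((1 - t) *\<^sub>R x0 + t *\<^sub>R x) k) = (\<lambda>k. h k + t * d k)"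
        unfolding h_def d_def by (auto simp: algebra_simps)
      finally have "0 \<le> t * (2 * dot n h d + t * sqn n d)"
        unfolding sqn_add by (simp add: power2_eq_square algebra_simps)
      then show ?thesis using t by (simp add: zero_le_mult_iff)
    qed
    have "0 \<le> dot n h d"
    proof (rule ccontr)
      assume neg: "\<not> 0 \<le> dot n h d"
      \<comment> \<open>For this \<open>t\<close> the quadratic term is at most
        \<open>- dot n h d\<close>, too small to offset \<open>2 * dot n h d\<close>. The summand 1
        in the denominator covers \<open>d = 0\<close>.\<close>
      define t where "t = min 1 (- dot n h d / (1 + sqn n d))"
      have sd: "0 < 1 + sqn n d" using sqn_nonneg[of n d] by linarith
      have t: "0 < t" "t \<le> 1" unfolding t_def using neg sd by (auto simp: divide_less_0_iff)
      have "t * sqn n d \<le> t * (1 + sqn n d)" using t by (intro mult_left_mono) auto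
      also have "\<dots> \<le> (- dot n h d / (1 + sqn n d)) * (1 + sqn n d)"
        unfolding t_def using sd by (intro mult_right_mono) auto
      also have "\<dots> = - dot n h d" using sd by simp
      finally show False using step[OF t] neg by simp
    qed
    moreover have "dot n h p - dot n h x = sqn n h + dot n h d"
      unfolding dot_self[symmetric] unfolding dot_def d_def h_def sum_subtractf[symmetric] sum.distrib[symmetric]
      by (rule sum.cong) (auto simp: algebra_simps)
    ultimately show ?thesis using hpos by simp
  qed
  then show ?thesis by blast
qed

lemma dot_emap: "dot n h (emap n c V y) = dot n h c + dot n (\<lambda>j. dot n h (V j)) y"
proof -
  have "dot n h (emap n c V y) = (\<Sum>k<n. h k * c k + (\<Sum>j<n. h k * (y j * V j k)))"
    unfolding dot_def emap_def by (rule sum.cong) (auto simp: ring_distribs sum_distrib_left)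
  also have "\<dots> = dot n h c + (\<Sum>j<n. \<Sum>k<n. h k * (y j * V j k))"
    unfolding sum.distrib dot_def by (subst (2) sum.swap) simp
  also have "(\<Sum>j<n. \<Sum>k<n. h k * (y j * V j k)) = dot n (\<lambda>j. dot n h (V j)) y"
    unfolding dot_def sum_distrib_right by (intro sum.cong refl) (simp add: mult_ac)
  finally show ?thesis .
qed

text \<open>A point outside \<open>K\<close> is separated from it, and in coordinates the separating
  functional is a vector \<open>g\<close>. Depth in direction \<open>g / |g|\<close> gives a point
  of \<open>K\<close> with value above \<open>\<rho>\<close> times \<open>|g|\<close>, whereas the
  excluded point has at most that value.\<close>

lemma depth_ball_subset:
  assumes n: "0 < n" and K: "K \<subseteq> supp_below n" "compact K" "convex K" "K \<noteq> {}"
    and deep: "\<And>u. sqn n u = 1 \<Longrightarrow> \<exists>y. emap n c V y \<in> K \<and> \<rho> < dot n u y"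
    and y: "sqn n y \<le> \<rho>\<^sup>2" and rho: "0 \<le> \<rho>"
  shows "emap n c V y \<in> K"
proof (rule ccontr)
  assume out: "emap n c V y \<notin> K"
  have "emap n c V y \<in> supp_below n" unfolding emap_def supp_below_def by auto
  then obtain h where h: "\<And>x. x \<in> K \<Longrightarrow> dot n h x < dot n h (emap n c V y)"
    using separating_functional[OF K _ out] by blast
  define g where "g j = dot n h (V j)" for j
  have less: "dot n g z < dot n g y" if "emap n c V z \<in> K" for z
    using h[OF that] unfolding dot_emap g_def by simp
  define s where "s = sqrt (sqn n g)"
  have s2: "s * s = sqn n g" unfolding s_def by simp
  show False
  proof (cases "s = 0")
    case True
    have "dot n g z = 0" for z using dot_le_sqrt[of n g z] True unfolding s_def by simp
    moreover have "\<exists>z. emap n c V z \<in> K"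
    proof -
      have "sqn n (\<lambda>k. if k = 0 then 1 else 0) = 1" unfolding sqn_def using n
        by (simp add: if_distrib[of "\<lambda>x. x\<^sup>2"] cong: if_cong)
      then show ?thesis using deep by blast
    qed
    ultimately show False using less by fastforce
  next
    case False
    then have s: "0 < s" unfolding s_def using sqn_nonneg[of n g] by (simp add: order_less_le)
    have "sqn n (\<lambda>k. (1 / s) * g k) = 1" unfolding sqn_scale s2[symmetric] using s by (simp add: power2_eq_square)
    then obtain z where z: "emap n c V z \<in> K" "\<rho> < dot n (\<lambda>k. (1 / s) * g k) z" using deep by blast
    have "dot n (\<lambda>k. (1 / s) * g k) z = (1 / s) * dot n g z"
      unfolding dot_def sum_distrib_left by (simp add: mult.assoc)
    then have "s * \<rho> < dot n g z" using z(2) s by (simp add: pos_less_divide_eq mult.commute)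
    also have "\<dots> < dot n g y" by (rule less[OF z(1)])
    also have "\<dots> \<le> s * sqrt (sqn n y)" using dot_le_sqrt[of n g y] unfolding s_def by linarith
    also have "\<dots> \<le> s * \<rho>" using y rho s by (intro mult_left_mono real_le_lsqrt) auto
    finally show False by simp
  qed
qed

section \<open>The weighted problem\<close>

lemma euclid_dist_eq: "euclid_dist n x y = sqrt (sqn n (\<lambda>k. x k - y k))"
  unfolding euclid_dist_def L2_set_def sqn_def ..

text \<open>The interior enters only through a point from which one small positive step along every
  axis stays in \<open>K\<close>; this feeds \<open>large_simplex\<close>.\<close>

lemma convex_bodyD:
  assumes "convex_body n K"
  shows "K \<subseteq> supp_below n" "compact K" "convex K" "K \<noteq> {}"
    "\<exists>p\<in>K. \<exists>r>0. \<forall>j<n. (\<lambda>k. p k + (if k = j then r else 0)) \<in> K"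
proof -
  have cpt: "compactin (product_topology (\<lambda>i. euclidean) UNIV) K" "K \<subseteq> supp_below n"
    using assms unfolding convex_body_def Euclidean_space_def compactin_subtopology supp_below_def by auto
  then show "compact K" "K \<subseteq> supp_below n"
    by (simp_all add: euclidean_product_topology)
  show "convex K" using assms unfolding convex_body_def by simp
  obtain p where p: "p \<in> Euclidean_space n interior_of K"
    using assms unfolding convex_body_def by blast
  then obtain U where U: "openin (Euclidean_space n) U" "p \<in> U" "U \<subseteq> K"
    unfolding interior_of_def by blast
  then obtain T where T: "openin (product_topology (\<lambda>i. euclidean) UNIV) T" "U = T \<inter> {x. \<forall>i\<ge>n. x i = (0 :: real)}"
    unfolding Euclidean_space_def openin_subtopology by blast
  have oT: "open T" using T(1) by (simp add: euclidean_product_topology)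
  have pT: "p \<in> T" "p \<in> supp_below n" using U(2) T(2) unfolding supp_below_def by auto
  \<comment> \<open>Each axis-parallel path through \<open>p\<close> is continuous for the product
    topology, so it remains in the open set \<open>T\<close> for small \<open>r\<close>; finitely
    many axes then allow one common \<open>r\<close>.\<close>
  have "\<forall>\<^sub>F r in at_right 0. (\<lambda>k. p k + (if k = j then r else 0)) \<in> T" for j
  proof -
    define \<gamma> where "\<gamma> r = (\<lambda>k. p k + (if k = j then r else 0))" for r :: real
    have "continuous_on UNIV \<gamma>"
      unfolding \<gamma>_def
    proof (rule continuous_on_coordinatewise_then_product)
      fix k show "continuous_on UNIV (\<lambda>r. p k + (if k = j then r else 0))"
        by (cases "k = j") (auto intro!: continuous_intros)
    qed
    then have "open (\<gamma> -` T)" using oT by (simp add: open_vimage)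
    moreover have "0 \<in> \<gamma> -` T" unfolding \<gamma>_def using pT(1) by simp
    ultimately have "\<forall>\<^sub>F r in at 0. r \<in> \<gamma> -` T"
      by (meson eventually_at_topological)
    then have "\<forall>\<^sub>F r in at_right 0. r \<in> \<gamma> -` T"
      by (rule filter_leD[OF at_le, rotated]) simp
    then show ?thesis unfolding \<gamma>_def by simp
  qed
  then have "\<forall>\<^sub>F r in at_right 0. \<forall>j\<in>{..<n}. (\<lambda>k. p k + (if k = j then r else 0)) \<in> T"
    by (intro eventually_ball_finite) auto
  moreover have "\<forall>\<^sub>F r in at_right 0. (0 :: real) < r" by (rule eventually_at_right_less)
  ultimately have "\<forall>\<^sub>F r in at_right 0. 0 < r \<and> (\<forall>j\<in>{..<n}. (\<lambda>k. p k + (if k = j then r else 0)) \<in> T)"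
    by eventually_elim simp
  then have "\<exists>r>0. \<forall>j\<in>{..<n}. (\<lambda>k. p k + (if k = j then r else 0)) \<in> T"
    by (rule eventually_happens'[OF trivial_limit_at_right_real])
  then obtain r where r: "0 < r" "\<And>j. j < n \<Longrightarrow> (\<lambda>k. p k + (if k = j then r else 0)) \<in> T"
    by auto
  have "(\<lambda>k. p k + (if k = j then r else 0)) \<in> K" if "j < n" for j
    using r(2)[OF that] pT(2) that U(3) unfolding T(2) supp_below_def by auto
  then show "\<exists>p\<in>K. \<exists>r>0. \<forall>j<n. (\<lambda>k. p k + (if k = j then r else 0)) \<in> K"
    using r(1) U(2,3) by blast
  then show "K \<noteq> {}" by blast
qed

text \<open>Compactness bounds the distances above, without which the supremum in
  \<open>euclid_diameter\<close> would say nothing.\<close>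

lemma euclid_dist_le_diameter:
  assumes K: "compact K" and x: "x \<in> K" and y: "y \<in> K"
  shows "euclid_dist n x y \<le> euclid_diameter n K"
proof -
  have co: "continuous_on (K \<times> K) (\<lambda>z. fst z i :: real)" "continuous_on (K \<times> K) (\<lambda>z. snd z i :: real)" for i
    by (rule continuous_on_product_then_coordinatewise[OF continuous_on_fst[OF continuous_on_id]],
        rule continuous_on_product_then_coordinatewise[OF continuous_on_snd[OF continuous_on_id]])
  have "continuous_on (K \<times> K) (\<lambda>z. sqrt (\<Sum>i<n. (fst z i - snd z i)\<^sup>2))"
    by (intro continuous_on_real_sqrt continuous_on_sum continuous_on_power continuous_on_diff co)
  then have "continuous_on (K \<times> K) (\<lambda>(x, y). euclid_dist n x y)"
    by (simp add: euclid_dist_eq sqn_def case_prod_beta)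
  then have "compact ((\<lambda>(x, y). euclid_dist n x y) ` (K \<times> K))"
    using K by (intro compact_continuous_image compact_Times)
  then have "bdd_above ((\<lambda>(x, y). euclid_dist n x y) ` (K \<times> K))"
    by (rule bounded_imp_bdd_above[OF compact_imp_bounded])
  then have "(case (x, y) of (x, y) \<Rightarrow> euclid_dist n x y) \<le> (SUP (x, y)\<in>K \<times> K. euclid_dist n x y)"
    using x y by (intro cSUP_upper) auto
  then show ?thesis using x unfolding euclid_diameter_def by auto
qed

text \<open>The Euclidean distance to a fixed point is continuous for the product topology and
  dominates the variation of \<open>f\<close>.\<close>

lemma euclid_lipschitz_continuous_on:
  assumes "euclid_lipschitz_on n L K f"
  shows "continuous_on K f"
  unfolding continuous_on_def
proof
  fix x assume x: "x \<in> K"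
  have "continuous_on UNIV (\<lambda>y. L * euclid_dist n y x)"
    unfolding euclid_dist_eq sqn_def by (intro continuous_intros)
  then have "((\<lambda>y. L * euclid_dist n y x) \<longlongrightarrow> L * euclid_dist n x x) (at x within K)"
    unfolding continuous_on_def by (blast intro: tendsto_within_subset)
  then have "((\<lambda>y. L * euclid_dist n y x) \<longlongrightarrow> 0) (at x within K)"
    by (simp add: euclid_dist_eq sqn_def)
  moreover have "\<forall>\<^sub>F y in at x within K. norm (f y - f x) \<le> L * euclid_dist n y x"
    using assms x unfolding euclid_lipschitz_on_def by (auto simp: eventually_at_filter)
  ultimately have "((\<lambda>y. f y - f x) \<longlongrightarrow> 0) (at x within K)"
    by (rule Lim_null_comparison[rotated])
  then show "(f \<longlongrightarrow> f x) (at x within K)" by (simp add: LIM_zero_iff)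
qed

lemma emap_affine: "u + v = 1 \<Longrightarrow> emap n c V (u *\<^sub>R y + v *\<^sub>R z) = u *\<^sub>R emap n c V y + v *\<^sub>R emap n c V z"
proof
  fix k assume uv: "u + v = 1"
  have "c k = u * c k + v * c k" using uv by (metis distrib_right mult_1)
  then show "emap n c V (u *\<^sub>R y + v *\<^sub>R z) k = (u *\<^sub>R emap n c V y + v *\<^sub>R emap n c V z) k"
    unfolding emap_def by (simp add: sum.distrib sum_distrib_left algebra_simps)
qed

lemma convex_on_emap:
  assumes "convex_on K g"
  shows "convex_on {y \<in> supp_below n. emap n c V y \<in> K} (\<lambda>y. g (emap n c V y))"
  unfolding convex_on_def
proof
  have K: "convex K" using assms unfolding convex_on_def by simp
  show "convex {y \<in> supp_below n. emap n c V y \<in> K}"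
    unfolding convex_def
  proof (intro ballI allI impI)
    fix x y u v assume h: "x \<in> {y \<in> supp_below n. emap n c V y \<in> K}" "y \<in> {y \<in> supp_below n. emap n c V y \<in> K}"
      "0 \<le> (u :: real)" "0 \<le> v" "u + v = 1"
    then have "u *\<^sub>R emap n c V x + v *\<^sub>R emap n c V y \<in> K" using K unfolding convex_def by simp
    then show "u *\<^sub>R x + v *\<^sub>R y \<in> {y \<in> supp_below n. emap n c V y \<in> K}"
      using h emap_affine[OF h(5)] by (auto simp: supp_below_def)
  qed
  show "\<forall>x\<in>{y \<in> supp_below n. emap n c V y \<in> K}. \<forall>y\<in>{y \<in> supp_below n. emap n c V y \<in> K}. \<forall>u\<ge>0. \<forall>v\<ge>0.
     u + v = 1 \<longrightarrow> g (emap n c V (u *\<^sub>R x + v *\<^sub>R y)) \<le> u * g (emap n c V x) + v * g (emap n c V y)"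
    using assms unfolding convex_on_def by (simp add: emap_affine)
qed

lemma continuous_on_emap: "continuous_on A (emap n c V)"
proof (rule continuous_on_coordinatewise_then_product)
  fix k
  show "continuous_on A (\<lambda>y. emap n c V y k)"
    by (cases "k < n") (auto simp: emap_def intro!: continuous_intros)
qed

text \<open>For \<open>\<epsilon> < 4\<close> the argument \<open>t\<close> of the logarithm is at
  least 5/4, so constant factors such as 128 can be absorbed into powers of \<open>t\<close>. The
  left side of the second bound is the log-volume range per dimension in
  \<open>weighted_detection\<close>.\<close>

lemma ln_ratio_bound:
  assumes n: "0 < n" and e: "0 < \<epsilon>" "\<epsilon> < 4"
  shows "1 / 5 \<le> ln (1 + real n / \<epsilon>)" "ln (32 * real n * sqrt (real n) / \<epsilon>) \<le> 24 * ln (1 + real n / \<epsilon>)"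
proof -
  define t where "t = 1 + real n / \<epsilon>"
  have n1: "1 \<le> real n" using n by simp
  have ne: "1 / 4 \<le> real n / \<epsilon>" using n1 e by (simp add: field_simps)
  then have t: "5 / 4 \<le> t" unfolding t_def by simp
  have "ln (1 / t) \<le> 1 / t - 1" using t by (intro ln_le_minus_one) simp
  moreover have "1 / t \<le> 4 / 5" using t by (simp add: field_simps)
  ultimately show "1 / 5 \<le> ln (1 + real n / \<epsilon>)" using t unfolding t_def[symmetric] by (simp add: ln_div)
  have "sqrt (real n) \<le> real n" using n1 by (intro real_le_lsqrt) (auto simp: power2_eq_square)
  also have "real n = \<epsilon> * (real n / \<epsilon>)" using e by simp
  also have "\<dots> \<le> 4 * t" unfolding t_def using e ne by (intro mult_mono) auto
  finally have s: "sqrt (real n) \<le> 4 * t" .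
  have "32 * real n * sqrt (real n) / \<epsilon> = 32 * (real n / \<epsilon>) * sqrt (real n)" by simp
  also have "\<dots> \<le> 32 * t * (4 * t)" 
    using s ne t e by (intro mult_mono) (auto simp: t_def divide_nonneg_pos)
  also have "\<dots> = 128 * t\<^sup>2" by (simp add: power2_eq_square)
  also have "128 \<le> t ^ 22"
  proof -
    have "(128 :: real) \<le> (5 / 4) ^ 22" by (simp add: power_divide)
    also have "\<dots> \<le> t ^ 22" using t by (intro power_mono) auto
    finally show ?thesis .
  qed
  then have "128 * t\<^sup>2 \<le> t ^ 22 * t\<^sup>2" by (intro mult_right_mono) auto
  also have "\<dots> = t ^ 24" by (simp add: power_add[symmetric])
  finally have "ln (32 * real n * sqrt (real n) / \<epsilon>) \<le> ln (t ^ 24)"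
    using n e t by (subst ln_le_cancel_iff) auto
  then show "ln (32 * real n * sqrt (real n) / \<epsilon>) \<le> 24 * ln (1 + real n / \<epsilon>)"
    using t unfolding t_def[symmetric] by (simp add: ln_realpow)
qed

lemma sum_UN_le:
  fixes w :: "'i \<Rightarrow> real"
  assumes "finite P" "\<And>p. p \<in> P \<Longrightarrow> finite (B p)" "\<And>p i. p \<in> P \<Longrightarrow> i \<in> B p \<Longrightarrow> 0 \<le> w i"
  shows "sum w (\<Union>p\<in>P. B p) \<le> (\<Sum>p\<in>P. sum w (B p))"
  using assms
proof (induction P rule: finite_induct)
  case (insert p P)
  let ?U = "\<Union>p\<in>P. B p"
  have "sum w (B p \<union> ?U) + sum w (B p \<inter> ?U) = sum w (B p) + sum w ?U"
    using insert by (intro sum.union_inter) auto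
  moreover have "0 \<le> sum w (B p \<inter> ?U)" using insert.prems by (intro sum_nonneg) auto
  moreover have "sum w ?U \<le> (\<Sum>p\<in>P. sum w (B p))" using insert by auto
  ultimately have "sum w (B p \<union> ?U) \<le> sum w (B p) + (\<Sum>p\<in>P. sum w (B p))" by linarith
  then show ?case using insert.hyps by simp
qed simp

text \<open>The dual problem: the deep ellipsoid supplies coordinates,
  \<open>detecting_points\<close> supplies at most \<open>2 * n + 1\<close> candidates, and
  pigeonhole selects one.\<close>

lemma weighted_detection:
  fixes w :: "'i \<Rightarrow> real" and g :: "'i \<Rightarrow> (nat \<Rightarrow> real) \<Rightarrow> real"
  assumes n: "0 < n" and K: "convex_body n K" "euclid_diameter n K \<le> 1"
    and f: "\<And>x. x \<in> K \<Longrightarrow> 0 \<le> f x" "convex_on K f" "euclid_lipschitz_on n 1 K f"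
    and e: "0 < \<epsilon>" "\<epsilon> < 4" and L: "L = ln (1 + real n / \<epsilon>)"
    and I: "finite I" and w0: "\<And>i. i \<in> I \<Longrightarrow> 0 \<le> w i" and w1: "(\<Sum>i\<in>I. w i) = 1"
    and g: "\<And>i. i \<in> I \<Longrightarrow> \<alpha> i \<in> K" "\<And>i. i \<in> I \<Longrightarrow> convex_on K (g i)"
      "\<And>i. i \<in> I \<Longrightarrow> euclid_lipschitz_on n 1 K (g i)" "\<And>i. i \<in> I \<Longrightarrow> g i (\<alpha> i) < - \<epsilon>"
  shows "\<exists>x\<in>K. 1 / (4608 * real n ^ 3 * L) \<le>
    sum w {i \<in> I. 1 / (1966080 * real n ^ 3 * L) * max \<epsilon> (f x) < \<bar>f x - g i x\<bar>}"
proof -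
  note KD = convex_bodyD[OF K(1)]
  have n1: "1 \<le> real n" using n by simp
  have L5: "1 / 5 \<le> L" unfolding L by (rule ln_ratio_bound(1)[OF n e])
  have dist1: "euclid_dist n x y \<le> 1" if "x \<in> K" "y \<in> K" for x y
    using euclid_dist_le_diameter[OF KD(2) that] K(2) by (meson order_trans)
  have coord: "\<bar>x k - y k\<bar> \<le> 1" if "x \<in> K" "y \<in> K" for x y k
  proof (cases "k < n")
    case True
    then show ?thesis
      using order_trans[OF abs_coord_le_sqn[OF True, of "\<lambda>k. x k - y k"]] dist1[OF that]
      unfolding euclid_dist_eq by blast
  next
    case False
    then have "x k = 0" "y k = 0" using that KD(1) unfolding supp_below_def by auto
    then show ?thesis by simp
  qed
  obtain p r where p: "p \<in> K" "0 < r" "\<And>j. j < n \<Longrightarrow> (\<lambda>k. p k + (if k = j then r else 0)) \<in> K"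
    using KD(5) by blast
  have "\<exists>v. detf n v \<noteq> 0 \<and> (\<forall>j<n. (\<lambda>k. p k + v j k) \<in> K) \<and>
    (\<forall>x\<in>K. \<exists>y. (\<forall>j<n. \<bar>y j\<bar> \<le> 2) \<and> x = emap n p v y)"
    by (rule large_simplex[OF KD(1) _ p(1,2)]) (simp_all add: coord p(3))
  then obtain v where v: "detf n v \<noteq> 0" "\<And>j. j < n \<Longrightarrow> (\<lambda>k. p k + v j k) \<in> K"
    "\<And>x. x \<in> K \<Longrightarrow> \<exists>y. (\<forall>j<n. \<bar>y j\<bar> \<le> 2) \<and> x = emap n p v y"
    by blast
  \<comment> \<open>Shrinking \<open>K\<close> towards \<open>\<alpha> i\<close> by this factor
    moves points at most \<open>\<epsilon> / 8\<close> from \<open>\<alpha> i\<close>, so the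
    1-Lipschitz \<open>g i\<close> stays below \<open>- (\<epsilon> / 2)\<close> on
    \<open>S i\<close>.\<close>
  define \<tau> where "\<tau> = \<epsilon> / 8"
  have tau: "0 < \<tau>" "\<tau> \<le> 1" unfolding \<tau>_def using e by auto
  define S where "S i = (\<lambda>x. (1 - \<tau>) *\<^sub>R \<alpha> i + \<tau> *\<^sub>R x) ` K" for i
  have SK: "S i \<subseteq> K" if "i \<in> I" for i
    using KD(3) g(1)[OF that] tau unfolding S_def convex_alt by auto
  define sq where "sq = sqrt (real n)"
  have sq: "1 \<le> sq" "sq * sq = real n" unfolding sq_def using n1 by auto
  \<comment> \<open>The cube of coordinates bounded by 2 lies in the ball of radius
    \<open>2 * sqrt n\<close>, so this dilation makes the initial ellipsoid contain
    \<open>K\<close>.\<close>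
  define V0 where "V0 i k = (2 * sq) * v i k" for i k
  have dV0: "detf n V0 = (2 * sq) ^ n * detf n v" unfolding V0_def by (rule detf_scale)
  have KE: "K \<subseteq> ell n p V0"
  proof
    fix x assume "x \<in> K"
    then obtain y where y: "\<And>j. j < n \<Longrightarrow> \<bar>y j\<bar> \<le> 2" "x = emap n p v y" using v(3) by blast
    define y' where "y' j = y j / (2 * sq)" for j
    have "y' j * V0 j k = y j * v j k" for j k unfolding y'_def V0_def using sq by simp
    then have "x = emap n p V0 y'" unfolding y(2) emap_def by (simp only:)
    moreover have "sqn n y' \<le> 1"
    proof -
      have "sqn n y' \<le> (\<Sum>j<n. 1 / real n)"
        unfolding sqn_def
      proof (rule sum_mono)
        fix j assume "j \<in> {..<n}"
        then have "(y j)\<^sup>2 \<le> 2\<^sup>2" using y(1)[of j] abs_le_square_iff[of "y j" 2] by simp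
        then have "(y j)\<^sup>2 / (4 * real n) \<le> 4 / (4 * real n)" using n by (intro divide_right_mono) auto
        then show "(y' j)\<^sup>2 \<le> 1 / real n"
          unfolding y'_def power_divide power_mult_distrib using sq(2) by (simp add: power2_eq_square)
      qed
      then show ?thesis using n by simp
    qed
    ultimately show "x \<in> ell n p V0" unfolding ell_def by blast
  qed
  \<comment> \<open>Each \<open>S i\<close> contains a copy of the large simplex scaled by
    \<open>\<tau>\<close>; this is the logarithm of the resulting volume bound.\<close>
  define lb where "lb = real n * ln (\<tau> / (2 * real n)) + ln \<bar>detf n v\<bar>"
  have lower: "lb \<le> ln \<bar>detf n V\<bar>" if i: "i \<in> I" and sub: "S i \<subseteq> ell n c V" for c V i
  proof -
    define b where "b = (1 - \<tau>) *\<^sub>R \<alpha> i + \<tau> *\<^sub>R p"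
    have "b \<in> S i" unfolding b_def S_def using p(1) by blast
    then have bE: "b \<in> ell n c V" using sub by blast
    have bvE: "(\<lambda>k. b k + \<tau> * v j k) \<in> ell n c V" if "j < n" for j
    proof -
      have "(\<lambda>k. b k + \<tau> * v j k) = (1 - \<tau>) *\<^sub>R \<alpha> i + \<tau> *\<^sub>R (\<lambda>k. p k + v j k)"
        unfolding b_def by (auto simp: algebra_simps)
      then have "(\<lambda>k. b k + \<tau> * v j k) \<in> S i" unfolding S_def using v(2)[OF that] by blast
      then show ?thesis using sub by blast
    qed
    have le: "\<tau> ^ n * \<bar>detf n v\<bar> \<le> (2 * real n) ^ n * \<bar>detf n V\<bar>"
      by (rule det_lower_bound[OF bE bvE]) (use tau in auto)
    have pos: "0 < \<tau> ^ n * \<bar>detf n v\<bar>" using tau v(1) by simp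
    have dV: "detf n V \<noteq> 0" using le pos by auto
    have "ln (\<tau> ^ n * \<bar>detf n v\<bar>) \<le> ln ((2 * real n) ^ n * \<bar>detf n V\<bar>)"
      using le pos dV n by (subst ln_le_cancel_iff) auto
    then have "real n * ln \<tau> + ln \<bar>detf n v\<bar> \<le> real n * ln (2 * real n) + ln \<bar>detf n V\<bar>"
      using tau v(1) dV n by (simp add: ln_mult ln_realpow distrib_left)
    then show ?thesis unfolding lb_def using tau n by (simp add: ln_div algebra_simps)
  qed
  define \<Lambda> where "\<Lambda> = 24 * real n * L"
  have Lam: "ln \<bar>detf n V0\<bar> - lb \<le> \<Lambda>" "1 \<le> \<Lambda>"
  proof -
    have "ln \<bar>detf n V0\<bar> = real n * ln (2 * sq) + ln \<bar>detf n v\<bar>"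
      unfolding dV0 using sq v(1) by (simp add: abs_mult ln_mult ln_realpow distrib_left)
    then have "ln \<bar>detf n V0\<bar> - lb = real n * (ln (2 * sq) - ln (\<tau> / (2 * real n)))"
      unfolding lb_def by (simp add: algebra_simps)
    also have "ln (2 * sq) - ln (\<tau> / (2 * real n)) = ln (2 * sq / (\<tau> / (2 * real n)))"
      using sq tau n by (subst ln_div) auto
    also have "2 * sq / (\<tau> / (2 * real n)) = 32 * real n * sqrt (real n) / \<epsilon>"
      unfolding \<tau>_def sq_def by simp
    also have "real n * ln (32 * real n * sqrt (real n) / \<epsilon>) \<le> real n * (24 * L)"
      unfolding L using ln_ratio_bound(2)[OF n e] by (intro mult_left_mono) auto
    finally show "ln \<bar>detf n V0\<bar> - lb \<le> \<Lambda>" unfolding \<Lambda>_def by simp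
    have "1 * (1 / 5) \<le> real n * L" using n1 L5 by (intro mult_mono) auto
    then show "1 \<le> \<Lambda>" unfolding \<Lambda>_def by simp
  qed
  have dV0': "detf n V0 \<noteq> 0" unfolding dV0 using sq v(1) by simp
  have SE: "S i \<subseteq> ell n p V0" if "i \<in> I" for i using SK[OF that] KE by blast
  have "\<exists>c V. detf n V \<noteq> 0 \<and> (\<forall>u. sqn n u = 1 \<longrightarrow>
    1 / (64 * real n * \<Lambda>) \<le> sum w {i \<in> I. S i \<subseteq> ell n c V \<and>
       (\<exists>y. sqn n y \<le> 1 \<and> emap n c V y \<in> S i \<and> 1 / (8 * real n) < dot n u y)})"
    by (rule deep_ellipsoid[where S = S, OF n I w0 w1 dV0' SE lower Lam])
  then obtain c V where dV: "detf n V \<noteq> 0" and deep: "\<And>u. sqn n u = 1 \<Longrightarrow>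
    1 / (64 * real n * \<Lambda>) \<le> sum w {i \<in> I. S i \<subseteq> ell n c V \<and>
       (\<exists>y. sqn n y \<le> 1 \<and> emap n c V y \<in> S i \<and> 1 / (8 * real n) < dot n u y)}"
    by blast
  define \<rho> where "\<rho> = 1 / (8 * real n)"
  have rho: "0 < \<rho>" "\<rho> \<le> 1" unfolding \<rho>_def using n1 by (auto simp: field_simps)
  define J where "J u = {i \<in> I. S i \<subseteq> ell n c V \<and>
       (\<exists>y. sqn n y \<le> 1 \<and> emap n c V y \<in> S i \<and> 1 / (8 * real n) < dot n u y)}" for u
  have qpos: "0 < 1 / (64 * real n * \<Lambda>)" using n Lam by simp
  define D where "D = {y \<in> supp_below n. emap n c V y \<in> K}"
  \<comment> \<open>Every direction has a positive weight of sets \<open>S i\<close> reaching past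
    depth \<open>\<rho>\<close>, and these sets lie in \<open>K\<close>; hence the coordinate ball
    of radius \<open>\<rho>\<close> maps into \<open>K\<close>.\<close>
  have ball: "y \<in> D" if "y \<in> supp_below n" "sqn n y \<le> \<rho>\<^sup>2" for y
  proof -
    have "emap n c V y \<in> K"
    proof (rule depth_ball_subset[OF n KD(1-4) _ that(2)])
      fix u assume "sqn n u = 1"
      then have "J u \<noteq> {}" using deep[of u] qpos unfolding J_def by (metis (lifting) linorder_not_le sum.empty)
      then show "\<exists>y. emap n c V y \<in> K \<and> \<rho> < dot n u y"
        unfolding J_def \<rho>_def using SK by blast
    qed (use rho in simp)
    then show ?thesis unfolding D_def using that by simp
  qed
  define F where "F y = f (emap n c V y)" for y
  have cvxF: "convex_on D F" unfolding D_def F_def[abs_def] by (rule convex_on_emap[OF f(2)])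
  have contF: "continuous_on {y \<in> supp_below n. sqn n y \<le> (\<rho> / 2)\<^sup>2} F"
  proof -
    have "(\<rho> / 2)\<^sup>2 \<le> \<rho>\<^sup>2" using rho by (simp add: power2_eq_square)
    then have "emap n c V ` {y \<in> supp_below n. sqn n y \<le> (\<rho> / 2)\<^sup>2} \<subseteq> K"
      using ball unfolding D_def by force
    then show ?thesis unfolding F_def
      by (rule continuous_on_compose2[OF euclid_lipschitz_continuous_on[OF f(3)] continuous_on_emap])
  qed
  have F0: "0 \<le> F y" if "y \<in> D" for y using that f(1) unfolding D_def F_def by simp
  have zD: "(\<lambda>_. 0) \<in> D" by (rule ball) (auto simp: supp_below_def sqn_def)
  \<comment> \<open>The oscillation is measured in the original metric, where \<open>K\<close> has
    diameter at most 1, however distorted the ellipsoid is.\<close>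
  have osc: "F y \<le> F (\<lambda>_. 0) + 1" if y: "y \<in> D" for y
  proof -
    have in_K: "emap n c V y \<in> K" "emap n c V (\<lambda>_. 0) \<in> K" using y zD unfolding D_def by auto
    have "\<bar>F y - F (\<lambda>_. 0)\<bar> \<le> 1 * euclid_dist n (emap n c V y) (emap n c V (\<lambda>_. 0))"
      using f(3) in_K unfolding euclid_lipschitz_on_def F_def by blast
    then show ?thesis using dist1[OF in_K] by simp
  qed
  have L': "ln (1 + 1 / \<epsilon>) \<le> L"
  proof -
    have "1 / \<epsilon> \<le> real n / \<epsilon>" using n1 e by (intro divide_right_mono) auto
    moreover have "0 < 1 / \<epsilon>" using e by simp
    ultimately show ?thesis unfolding L by (subst ln_le_cancel_iff) linarith+
  qed
  have Dsub: "D \<subseteq> supp_below n" unfolding D_def by blast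
  have "\<exists>u P. sqn n u = 1 \<and> finite P \<and> card P \<le> 2 * n + 1 \<and> P \<subseteq> D \<and>
    (\<forall>G. \<forall>\<beta>\<in>D. convex_on D G \<longrightarrow> sqn n \<beta> \<le> 1 \<longrightarrow> \<rho> \<le> dot n u \<beta> \<longrightarrow> G \<beta> < - (\<epsilon> / 2) \<longrightarrow>
       (\<exists>p\<in>P. \<rho>\<^sup>2 / (30720 * L * real n) * max \<epsilon> (F p) < \<bar>F p - G p\<bar>))"
    by (rule detecting_points[OF n Dsub ball cvxF contF F0 osc e(1) L' L5 rho])
  then obtain u P where u: "sqn n u = 1" and P: "finite P" "card P \<le> 2 * n + 1" "P \<subseteq> D"
    and det: "\<And>G \<beta>. convex_on D G \<Longrightarrow> \<beta> \<in> D \<Longrightarrow> sqn n \<beta> \<le> 1 \<Longrightarrow> \<rho> \<le> dot n u \<beta> \<Longrightarrow> G \<beta> < - (\<epsilon> / 2) \<Longrightarrow>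
       \<exists>p\<in>P. \<rho>\<^sup>2 / (30720 * L * real n) * max \<epsilon> (F p) < \<bar>F p - G p\<bar>"
    by blast
  have delta: "\<rho>\<^sup>2 / (30720 * L * real n) = 1 / (1966080 * real n ^ 3 * L)"
    unfolding \<rho>_def by (simp add: power2_eq_square power3_eq_cube)
  define B where "B x = {i \<in> I. 1 / (1966080 * real n ^ 3 * L) * max \<epsilon> (f x) < \<bar>f x - g i x\<bar>}" for x
  have "J u \<subseteq> (\<Union>p\<in>P. B (emap n c V p))"
  proof
    fix i assume i: "i \<in> J u"
    then obtain y where iI: "i \<in> I" and y: "sqn n y \<le> 1" "emap n c V y \<in> S i" "\<rho> < dot n u y"
      unfolding J_def \<rho>_def by blast
    \<comment> \<open>\<open>y\<close> may be nonzero from index \<open>n\<close> on; truncation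
      puts it into \<open>D\<close> and changes none of the quantities involved.\<close>
    define \<beta> where "\<beta> j = (if j < n then y j else 0)" for j
    have \<beta>: "\<beta> \<in> supp_below n" "sqn n \<beta> = sqn n y" "dot n u \<beta> = dot n u y" "emap n c V \<beta> = emap n c V y"
      unfolding \<beta>_def supp_below_def sqn_def dot_def emap_def by auto
    have bK: "emap n c V \<beta> \<in> K" using y(2) SK[OF iI] unfolding \<beta>(4) by blast
    obtain x where x: "x \<in> K" "emap n c V \<beta> = (1 - \<tau>) *\<^sub>R \<alpha> i + \<tau> *\<^sub>R x" using y(2) unfolding \<beta>(4) S_def by blast
    have "(\<lambda>k. emap n c V \<beta> k - \<alpha> i k) = (\<lambda>k. \<tau> * (x k - \<alpha> i k))"
      unfolding x(2) by (auto simp: algebra_simps)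
    then have "euclid_dist n (emap n c V \<beta>) (\<alpha> i) = \<tau> * euclid_dist n x (\<alpha> i)"
      unfolding euclid_dist_eq by (simp add: sqn_scale real_sqrt_mult tau(1) less_imp_le)
    also have "\<dots> \<le> \<tau> * 1" using dist1[OF x(1) g(1)[OF iI]] tau by (intro mult_left_mono) auto
    finally have db: "euclid_dist n (emap n c V \<beta>) (\<alpha> i) \<le> \<tau>" by simp
    have "\<bar>g i (emap n c V \<beta>) - g i (\<alpha> i)\<bar> \<le> 1 * euclid_dist n (emap n c V \<beta>) (\<alpha> i)"
      using g(3)[OF iI] bK g(1)[OF iI] unfolding euclid_lipschitz_on_def by blast
    then have gb: "g i (emap n c V \<beta>) < - (\<epsilon> / 2)" using db g(4)[OF iI] e unfolding \<tau>_def by linarith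
    have "convex_on D (\<lambda>y. g i (emap n c V y))" unfolding D_def by (rule convex_on_emap[OF g(2)[OF iI]])
    moreover have "\<beta> \<in> D" unfolding D_def using \<beta>(1) bK by simp
    ultimately obtain p where "p \<in> P" "\<rho>\<^sup>2 / (30720 * L * real n) * max \<epsilon> (F p) < \<bar>F p - g i (emap n c V p)\<bar>"
      using det[of "\<lambda>y. g i (emap n c V y)" \<beta>] gb y(1,3) \<beta>(2,3) by auto
    then show "i \<in> (\<Union>p\<in>P. B (emap n c V p))" using iI unfolding B_def delta F_def by blast
  qed
  then have "sum w (J u) \<le> sum w (\<Union>p\<in>P. B (emap n c V p))"
    using I P w0 by (intro sum_mono2) (auto simp: B_def)
  also have "\<dots> \<le> (\<Sum>p\<in>P. sum w (B (emap n c V p)))"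
    using P(1) I w0 by (intro sum_UN_le) (auto simp: B_def)
  finally have tot: "1 / (64 * real n * \<Lambda>) \<le> (\<Sum>p\<in>P. sum w (B (emap n c V p)))"
    using deep[OF u] unfolding J_def by linarith
  show ?thesis
  proof (rule ccontr)
    assume no: "\<not> ?thesis"
    define q where "q = 1 / (4608 * real n ^ 3 * L)"
    have q0: "0 < q" unfolding q_def using n L5 by simp
    have small: "sum w (B (emap n c V p)) < q" if "p \<in> P" for p
      using no that P(3) unfolding D_def B_def q_def by (auto simp: not_le)
    have "P \<noteq> {}" using tot qpos by auto
    then have "(\<Sum>p\<in>P. sum w (B (emap n c V p))) < (\<Sum>p\<in>P. q)"
      using P(1) small by (intro sum_strict_mono) auto
    also have "\<dots> = real (card P) * q" by simp
    \<comment> \<open>The \<open>2 * n + 1\<close> points number at most \<open>3 * n\<close>, and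
      \<open>3 * n * q\<close> equals the weight per direction since
      \<open>\<Lambda> = 24 * n * L\<close>.\<close>
    also have "\<dots> \<le> (3 * real n) * q"
    proof -
      have "card P \<le> 3 * n" using P(2) n by linarith
      then have "real (card P) \<le> 3 * real n" by (metis of_nat_le_iff of_nat_mult of_nat_numeral)
      then show ?thesis using q0 by (intro mult_right_mono) auto
    qed
    also have "\<dots> = 1 / (64 * real n * \<Lambda>)"
      unfolding q_def \<Lambda>_def using n L5 by (simp add: power3_eq_cube field_simps)
    finally show False using tot by simp
  qed
qed

section \<open>Passing to a measure\<close>

text \<open>In each round the weights of the detected indices are halved. The total shrinks by a
  factor \<open>1 - q / 2\<close> at least, while an index detected \<open>m\<close> times keeps
  \<open>2 ^ (- m)\<close>; for many rounds every \<open>m\<close> is therefore a fixed fraction of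
  \<open>T\<close>.\<close>

lemma multiplicative_weights:
  fixes D :: "'i \<Rightarrow> 'a \<Rightarrow> bool"
  assumes I: "finite I" "I \<noteq> {}" and q: "0 < q"
    and dual: "\<And>w :: 'i \<Rightarrow> real. (\<And>i. i \<in> I \<Longrightarrow> 0 \<le> w i) \<Longrightarrow> (\<Sum>i\<in>I. w i) = 1 \<Longrightarrow>
      \<exists>x\<in>K. q \<le> sum w {i \<in> I. D i x}"
  shows "\<exists>T xs. 0 < T \<and> (\<forall>t. xs t \<in> K) \<and> (\<forall>i\<in>I. q / 4 * real T \<le> real (card {t. t < T \<and> D i (xs t)}))"
proof -
  \<comment> \<open>The homogeneous form of the dual hypothesis, since the running weights are not
    normalized.\<close>
  have step: "\<exists>x\<in>K. q * sum w I \<le> sum w {i \<in> I. D i x}" if w: "\<And>i. 0 < w i" for w :: "'i \<Rightarrow> real"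
  proof -
    have s: "0 < sum w I" using I w by (intro sum_pos) auto
    obtain x where x: "x \<in> K" "q \<le> sum (\<lambda>i. w i / sum w I) {i \<in> I. D i x}"
      using dual[of "\<lambda>i. w i / sum w I"] w s by (auto simp: sum_divide_distrib[symmetric] less_imp_le)
    then have "q \<le> sum w {i \<in> I. D i x} / sum w I" by (simp add: sum_divide_distrib)
    then show ?thesis using x(1) s by (auto simp: pos_le_divide_eq)
  qed
  define sel where "sel w = (SOME x. x \<in> K \<and> q * sum w I \<le> sum w {i \<in> I. D i x})" for w :: "'i \<Rightarrow> real"
  have sel': "sel w \<in> K \<and> q * sum w I \<le> sum w {i \<in> I. D i (sel w)}" if w: "\<And>i. 0 < w i" for w
  proof -
    have "\<exists>x. x \<in> K \<and> q * sum w I \<le> sum w {i \<in> I. D i x}" using step[of w, OF w] by auto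
    then show ?thesis unfolding sel_def by (rule someI_ex)
  qed
  then have sel: "sel w \<in> K" "q * sum w I \<le> sum w {i \<in> I. D i (sel w)}" if "\<And>i. 0 < w i" for w
    using that by auto
  \<comment> \<open>The point of a round depends only on the current weights, so recursion on the
    weight function alone suffices.\<close>
  define W where "W = rec_nat (\<lambda>_. 1 :: real) (\<lambda>_ v i. v i * (if D i (sel v) then 1 / 2 else 1))"
  have W0: "W 0 i = 1" and WS: "W (Suc t) i = W t i * (if D i (sel (W t)) then 1 / 2 else 1)" for t i
    unfolding W_def by simp_all
  define xs where "xs t = sel (W t)" for t
  have Wpos: "0 < W t i" for t i by (induction t) (auto simp: W0 WS)
  have Wcard: "W t i = (1 / 2) ^ card {s. s < t \<and> D i (xs s)}" for t i
  proof (induction t)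
    case (Suc t)
    have "{s. s < Suc t \<and> D i (xs s)} = (if D i (xs t) then insert t {s. s < t \<and> D i (xs s)} else {s. s < t \<and> D i (xs s)})"
      by (auto simp: less_Suc_eq)
    then have "card {s. s < Suc t \<and> D i (xs s)} = card {s. s < t \<and> D i (xs s)} + (if D i (xs t) then 1 else 0)"
      by simp
    then show ?case using Suc unfolding WS xs_def by simp
  qed (simp add: W0)
  have Wsum: "sum (W t) I \<le> real (card I) * exp (- (q / 2) * real t)" for t
  proof (induction t)
    case 0 then show ?case by (simp add: W0)
  next
    case (Suc t)
    have "sum (W (Suc t)) I = sum (W t) I - (1 / 2) * (\<Sum>i\<in>I. if D i (xs t) then W t i else 0)"
      unfolding WS sum_distrib_left sum_subtractf[symmetric] by (rule sum.cong) (auto simp: xs_def)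
    also have "(\<Sum>i\<in>I. if D i (xs t) then W t i else 0) = sum (W t) {i \<in> I. D i (xs t)}"
      using I by (simp add: sum.inter_filter)
    also have "sum (W t) I - (1 / 2) * sum (W t) {i \<in> I. D i (xs t)} \<le> sum (W t) I * (1 - q / 2)"
      using sel(2)[of "W t", OF Wpos] unfolding xs_def by (simp add: algebra_simps)
    also have "\<dots> \<le> sum (W t) I * exp (- (q / 2))"
      using exp_ge_add_one_self[of "- (q / 2)"] Wpos by (intro mult_left_mono sum_nonneg) (auto intro: less_imp_le)
    also have "\<dots> \<le> real (card I) * exp (- (q / 2) * real t) * exp (- (q / 2))"
      using Suc by (intro mult_right_mono) auto
    also have "\<dots> = real (card I) * exp (- (q / 2) * real (Suc t))"
      by (simp add: exp_add[symmetric] algebra_simps)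
    finally show ?case .
  qed
  have N: "1 \<le> real (card I)" using I by (simp add: Suc_leI card_gt_0_iff)
  \<comment> \<open>With this many rounds, \<open>ln (card I)\<close> uses up at most half of the
    decay \<open>q / 2 * T\<close>, which leaves \<open>q / 4 * T\<close>.\<close>
  obtain T :: nat where T: "4 * ln (real (card I)) / q < real T" using reals_Archimedean2 by blast
  have lnN: "0 \<le> ln (real (card I))" using N by simp
  have "0 < T" using T lnN q by (metis divide_nonneg_pos leD mult_nonneg_nonneg of_nat_0 of_nat_0_less_iff zero_le_numeral not_gr_zero)
  moreover have "q / 4 * real T \<le> real (card {t. t < T \<and> D i (xs t)})" if i: "i \<in> I" for i
  proof -
    let ?m = "card {t. t < T \<and> D i (xs t)}"
    have "(1 / 2) ^ ?m \<le> sum (W T) I"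
      unfolding Wcard[symmetric] using I i Wpos by (intro member_le_sum) (auto intro: less_imp_le)
    also have "\<dots> \<le> real (card I) * exp (- (q / 2) * real T)" by (rule Wsum)
    finally have "ln ((1 / 2 :: real) ^ ?m) \<le> ln (real (card I) * exp (- (q / 2) * real T))"
      using N by (subst ln_le_cancel_iff) auto
    then have "- (real ?m * ln 2) \<le> ln (real (card I)) - (q / 2) * real T"
      using N by (simp add: ln_mult ln_realpow ln_div)
    moreover have "real ?m * ln 2 \<le> real ?m * 1" using ln_2_less_1 by (intro mult_left_mono) auto
    moreover have "ln (real (card I)) \<le> q / 4 * real T" using T q by (simp add: pos_divide_less_eq mult.commute)
    ultimately show ?thesis by simp
  qed
  moreover have "xs t \<in> K" for t unfolding xs_def by (rule sel(1)) (rule Wpos)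
  ultimately show ?thesis by blast
qed

text \<open>Push-forward of the uniform distribution on the rounds, so repeated points count with
  multiplicity.\<close>

lemma empirical_measure:
  fixes K :: "(nat \<Rightarrow> real) set"
  assumes T: "0 < T" and xs: "\<And>t. xs t \<in> K"
  shows "\<exists>\<mu>. prob_measure_on K \<mu> \<and>
    (\<forall>A\<in>sets (restrict_space borel K). measure \<mu> A = real (card {t. t < T \<and> xs t \<in> A}) / real T)"
proof -
  let ?p = "measure_pmf (pmf_of_set {..<T})"
  define \<mu> where "\<mu> = distr ?p (restrict_space borel K) xs"
  have m: "xs \<in> measurable ?p (restrict_space borel K)"
    using xs by (simp add: space_restrict_space)
  have "prob_measure_on K \<mu>"
    unfolding prob_measure_on_def \<mu>_def using m by (auto intro!: prob_space.prob_space_distr prob_space_measure_pmf)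
  moreover have "measure \<mu> A = real (card {t. t < T \<and> xs t \<in> A}) / real T" if A: "A \<in> sets (restrict_space borel K)" for A
  proof -
    have "measure \<mu> A = measure ?p (xs -` A)" unfolding \<mu>_def using m A by (simp add: measure_distr)
    also have "\<dots> = real (card ({..<T} \<inter> xs -` A)) / real T" using T by (subst measure_pmf_of_set) auto
    also have "{..<T} \<inter> xs -` A = {t. t < T \<and> xs t \<in> A}" by auto
    finally show ?thesis .
  qed
  ultimately show ?thesis by blast
qed

section \<open>Finite nets of Lipschitz functions\<close>

lemma finite_net:
  assumes K: "compact K" and s: "0 < \<sigma>"
  shows "\<exists>P. finite P \<and> P \<subseteq> K \<and> (\<forall>x\<in>K. \<exists>p\<in>P. euclid_dist n x p < \<sigma>)"
proof -
  have "open {y. euclid_dist n y x < \<sigma>}" for x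
    unfolding euclid_dist_eq sqn_def by (intro open_Collect_less continuous_intros)
  moreover have "K \<subseteq> (\<Union>x\<in>K. {y. euclid_dist n y x < \<sigma>})"
    using s by (auto simp: euclid_dist_eq sqn_def)
  ultimately obtain P where P: "P \<subseteq> K" "finite P" "K \<subseteq> (\<Union>x\<in>P. {y. euclid_dist n y x < \<sigma>})"
    using compactE_image[OF K, of K "\<lambda>x. {y. euclid_dist n y x < \<sigma>}"] by metis
  have "\<exists>p\<in>P. euclid_dist n x p < \<sigma>" if "x \<in> K" for x
    using subsetD[OF P(3) that] by simp
  then show ?thesis using P(1,2) by (intro exI[of _ P] conjI ballI)
qed

text \<open>Values at a finite net of points, rounded to multiples of \<open>\<sigma>\<close>, give
  finitely many keys. Functions with equal keys differ by less than \<open>\<sigma>\<close> on the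
  net, and moving to a net point costs another \<open>\<sigma>\<close> for each function.\<close>

lemma finite_lipschitz_net:
  assumes K: "compact K" and s: "0 < \<sigma>"
    and lip: "\<And>g. g \<in> \<G> \<Longrightarrow> euclid_lipschitz_on n 1 K g" and bd: "\<And>g x. g \<in> \<G> \<Longrightarrow> x \<in> K \<Longrightarrow> \<bar>g x\<bar> \<le> b"
  shows "\<exists>\<F>. finite \<F> \<and> \<F> \<subseteq> \<G> \<and> (\<forall>g\<in>\<G>. \<exists>h\<in>\<F>. \<forall>x\<in>K. \<bar>g x - h x\<bar> \<le> 3 * \<sigma>)"
proof -
  obtain P where P: "finite P" "P \<subseteq> K" "\<And>x. x \<in> K \<Longrightarrow> \<exists>p\<in>P. euclid_dist n x p < \<sigma>"
    using finite_net[OF K s, of n] by metis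
  define key where "key g = restrict (\<lambda>p. \<lfloor>g p / \<sigma>\<rfloor>) P" for g :: "(nat \<Rightarrow> real) \<Rightarrow> real"
  have "key g \<in> Pi\<^sub>E P (\<lambda>_. {\<lfloor>- b / \<sigma>\<rfloor>..\<lfloor>b / \<sigma>\<rfloor>})" if g: "g \<in> \<G>" for g
  proof -
    have "\<lfloor>g p / \<sigma>\<rfloor> \<in> {\<lfloor>- b / \<sigma>\<rfloor>..\<lfloor>b / \<sigma>\<rfloor>}" if "p \<in> P" for p
    proof -
      have "\<bar>g p\<bar> \<le> b" using bd[OF g] P(2) that by blast
      then have "- b \<le> g p" "g p \<le> b" by linarith+
      then have "- b / \<sigma> \<le> g p / \<sigma>" "g p / \<sigma> \<le> b / \<sigma>"
        using s by (intro divide_right_mono; simp)+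
      then show ?thesis by (simp add: floor_mono)
    qed
    then show ?thesis unfolding key_def by (simp add: restrict_PiE_iff)
  qed
  then have fin: "finite (key ` \<G>)"
    by (intro finite_subset[OF _ finite_PiE[OF P(1), of "\<lambda>_. {\<lfloor>- b / \<sigma>\<rfloor>..\<lfloor>b / \<sigma>\<rfloor>}"]]) auto
  \<comment> \<open>One representative per key, taken from the family itself, so that it keeps the
    defining properties of the family.\<close>
  define \<F> where "\<F> = inv_into \<G> key ` (key ` \<G>)"
  have "\<bar>g x - inv_into \<G> key (key g) x\<bar> \<le> 3 * \<sigma>" if g: "g \<in> \<G>" and x: "x \<in> K" for g x
  proof -
    define h where "h = inv_into \<G> key (key g)"
    have "key g \<in> key ` \<G>" using g by simp
    then have h: "h \<in> \<G>" "key h = key g"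
      unfolding h_def by (rule inv_into_into, rule f_inv_into_f)
    obtain p where p: "p \<in> P" "euclid_dist n x p < \<sigma>" using P(3)[OF x] by blast
    have pK: "p \<in> K" using p P by blast
    have "\<lfloor>g p / \<sigma>\<rfloor> = \<lfloor>h p / \<sigma>\<rfloor>" using fun_cong[OF h(2), of p] p(1) unfolding key_def by simp
    then have "\<bar>g p / \<sigma> - h p / \<sigma>\<bar> < 1" by linarith
    then have "\<bar>(g p - h p) / \<sigma>\<bar> < 1" by (simp add: diff_divide_distrib)
    then have gh: "\<bar>g p - h p\<bar> < \<sigma>" using s by (simp add: abs_divide)
    have "\<bar>g x - g p\<bar> \<le> 1 * euclid_dist n x p" "\<bar>h x - h p\<bar> \<le> 1 * euclid_dist n x p"
      using lip[OF g] lip[OF h(1)] x pK unfolding euclid_lipschitz_on_def by blast+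
    then show ?thesis using p(2) gh unfolding h_def[symmetric] by linarith
  qed
  moreover have "\<F> \<subseteq> \<G>" unfolding \<F>_def by (auto intro: inv_into_into)
  moreover have "finite \<F>" unfolding \<F>_def using fin by simp
  ultimately show ?thesis unfolding \<F>_def by blast
qed

text \<open>Functions below \<open>- (\<epsilon> / 2)\<close> throughout \<open>K\<close> are
  detected at every point. The others are uniformly bounded, so a finite net represents them, and
  multiplicative weights apply to the net.\<close>

lemma exploration_points:
  assumes n: "0 < n" and K: "convex_body n K" "euclid_diameter n K \<le> 1"
    and f: "\<And>x. x \<in> K \<Longrightarrow> 0 \<le> f x" "convex_on K f" "euclid_lipschitz_on n 1 K f"
    and e: "0 < \<epsilon>" "\<epsilon> \<le> real n" and L: "L = ln (1 + real n / \<epsilon>)"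
  shows "\<exists>T xs. 0 < T \<and> (\<forall>t. xs t \<in> K) \<and>
    (\<forall>\<alpha>\<in>K. \<forall>g. convex_on K g \<longrightarrow> euclid_lipschitz_on n 1 K g \<longrightarrow> g \<alpha> < - \<epsilon> \<longrightarrow>
      1 / (18432 * real n ^ 3 * L) * real T \<le>
        real (card {t. t < T \<and> \<bar>f (xs t) - g (xs t)\<bar> > 1 / (3932160 * real n ^ 3 * L) * max \<epsilon> (f (xs t))}))"
proof -
  note KD = convex_bodyD[OF K(1)]
  have n1: "1 \<le> real n ^ 3" using n by simp
  \<comment> \<open>By \<open>\<epsilon> \<le> real n\<close> the logarithm is at least
    \<open>ln 2\<close>. This yields \<open>q / 4 \<le> 1\<close> and
    \<open>\<delta> \<le> 1 / 2\<close>, used for the functions detected everywhere.\<close>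
  have L2: "1 / 2 \<le> L"
  proof -
    have "ln 2 \<le> L" unfolding L using e by (subst ln_le_cancel_iff) (auto simp: field_simps add_pos_pos)
    then show ?thesis using ln2_ge_two_thirds by linarith
  qed
  have nL: "1 / 2 \<le> real n ^ 3 * L" using mult_mono[OF n1 L2] by simp
  define \<delta> where "\<delta> = 1 / (3932160 * real n ^ 3 * L)"
  define q where "q = 1 / (4608 * real n ^ 3 * L)"
  have q: "0 < q" "q / 4 \<le> 1" "q / 4 = 1 / (18432 * real n ^ 3 * L)" unfolding q_def using nL by (auto simp: field_simps)
  have d: "0 < \<delta>" "\<delta> \<le> 1 / 2" "2 * \<delta> = 1 / (1966080 * real n ^ 3 * L)"
    unfolding \<delta>_def using nL by (auto simp: field_simps)
  have lip: "\<bar>g x - g y\<bar> \<le> 1" if "euclid_lipschitz_on n 1 K g" "x \<in> K" "y \<in> K" for g x y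
  proof -
    have "\<bar>g x - g y\<bar> \<le> 1 * euclid_dist n x y" using that unfolding euclid_lipschitz_on_def by blast
    then show ?thesis using euclid_dist_le_diameter[OF KD(2) that(2,3), of n] K(2) by linarith
  qed
  define D where "D g x \<longleftrightarrow> \<delta> * max \<epsilon> (f x) < \<bar>f x - g x\<bar>" for g x
  have easy: "D g x" if "x \<in> K" "g x < - (\<epsilon> / 2)" for g x
  proof -
    have "\<delta> * max \<epsilon> (f x) \<le> 1 / 2 * max \<epsilon> (f x)" using d e by (intro mult_right_mono) auto
    also have "\<dots> < f x - g x" using that f(1)[OF that(1)] e by (auto simp: max_def)
    finally show ?thesis unfolding D_def by linarith
  qed
  define \<G> where "\<G> = {g. convex_on K g \<and> euclid_lipschitz_on n 1 K g \<and> (\<exists>\<alpha>\<in>K. g \<alpha> < - \<epsilon>) \<and>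
     (\<exists>x\<in>K. - (\<epsilon> / 2) \<le> g x)}"
  have bd: "\<bar>g x\<bar> \<le> \<epsilon> + 1" if "g \<in> \<G>" "x \<in> K" for g x
  proof -
    obtain a b where ab: "a \<in> K" "g a < - \<epsilon>" "b \<in> K" "- (\<epsilon> / 2) \<le> g b" and l: "euclid_lipschitz_on n 1 K g"
      using \<open>g \<in> \<G>\<close> unfolding \<G>_def by blast
    show ?thesis using lip[OF l that(2) ab(1)] lip[OF l that(2) ab(3)] ab(2,4) e unfolding abs_le_iff by linarith
  qed
  \<comment> \<open>The net error \<open>3 * \<sigma> = \<delta> * \<epsilon>\<close> is at most one
    threshold, so detection of the representative at \<open>2 * \<delta>\<close> implies detection
    at \<open>\<delta>\<close>.\<close>
  define \<sigma> where "\<sigma> = \<delta> * \<epsilon> / 3"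
  have s: "0 < \<sigma>" unfolding \<sigma>_def using d e by simp
  have "\<exists>\<F>. finite \<F> \<and> \<F> \<subseteq> \<G> \<and> (\<forall>g\<in>\<G>. \<exists>h\<in>\<F>. \<forall>x\<in>K. \<bar>g x - h x\<bar> \<le> 3 * \<sigma>)"
    by (rule finite_lipschitz_net[OF KD(2) s, of _ n "\<epsilon> + 1"]) (auto simp: bd, simp add: \<G>_def)
  then obtain \<F> where F: "finite \<F>" "\<F> \<subseteq> \<G>" "\<And>g. g \<in> \<G> \<Longrightarrow> \<exists>h\<in>\<F>. \<forall>x\<in>K. \<bar>g x - h x\<bar> \<le> 3 * \<sigma>"
    by blast
  have transfer: "D g x" if h: "\<forall>x\<in>K. \<bar>g x - h x\<bar> \<le> 3 * \<sigma>" and x: "x \<in> K"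
    and det: "2 * \<delta> * max \<epsilon> (f x) < \<bar>f x - h x\<bar>" for g h x
  proof -
    have "3 * \<sigma> \<le> \<delta> * max \<epsilon> (f x)" unfolding \<sigma>_def using d by simp
    then show ?thesis using h[rule_format, OF x] det unfolding D_def by linarith
  qed
  have "\<exists>T xs. 0 < T \<and> (\<forall>t. xs t \<in> K) \<and>
    (\<forall>h\<in>\<F>. q / 4 * real T \<le> real (card {t. t < T \<and> 2 * \<delta> * max \<epsilon> (f (xs t)) < \<bar>f (xs t) - h (xs t)\<bar>}))"
  proof (cases "\<F> = {}")
    \<comment> \<open>An empty net imposes no condition, but a positive \<open>T\<close> and a
      sequence in \<open>K\<close> must still be supplied.\<close>
    case True
    obtain p where "p \<in> K" using KD(4) by blast
    then show ?thesis using True by (intro exI[of _ "1 :: nat"] exI[of _ "\<lambda>_. p"]) simp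
  next
    case False
    have "\<exists>h. h \<in> \<F>" using False by blast
    \<comment> \<open>A net function falls below \<open>- \<epsilon>\<close> and reaches
      \<open>- (\<epsilon> / 2)\<close> within distance 1, which even forces
      \<open>\<epsilon> < 2\<close>.\<close>
    then have e4: "\<epsilon> < 4"
    proof
      fix h assume "h \<in> \<F>"
      then obtain a b where "a \<in> K" "h a < - \<epsilon>" "b \<in> K" "- (\<epsilon> / 2) \<le> h b" "euclid_lipschitz_on n 1 K h"
        using F(2) unfolding \<G>_def by blast
      then show ?thesis using lip[of h a b] unfolding abs_le_iff by linarith
    qed
    have "\<forall>h. \<exists>a. h \<in> \<F> \<longrightarrow> a \<in> K \<and> h a < - \<epsilon>" using F(2) unfolding \<G>_def by blast
    then obtain \<alpha> where \<alpha>: "\<And>h. h \<in> \<F> \<Longrightarrow> \<alpha> h \<in> K" "\<And>h. h \<in> \<F> \<Longrightarrow> h (\<alpha> h) < - \<epsilon>" by metis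
    have hF: "convex_on K h" "euclid_lipschitz_on n 1 K h" if "h \<in> \<F>" for h
      using that F(2) unfolding \<G>_def by auto
    show ?thesis
    proof (rule multiplicative_weights[where D = "\<lambda>h x. 2 * \<delta> * max \<epsilon> (f x) < \<bar>f x - h x\<bar>", OF F(1) False q(1)])
      fix w :: "((nat \<Rightarrow> real) \<Rightarrow> real) \<Rightarrow> real"
      assume w: "\<And>i. i \<in> \<F> \<Longrightarrow> 0 \<le> w i" "sum w \<F> = 1"
      show "\<exists>x\<in>K. q \<le> sum w {i \<in> \<F>. 2 * \<delta> * max \<epsilon> (f x) < \<bar>f x - i x\<bar>}"
        unfolding q_def d(3)
        by (rule weighted_detection[where g = "\<lambda>h. h" and \<alpha> = \<alpha>, OF n K f e(1) e4 L F(1)])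
          (simp_all add: w \<alpha> hF)
    qed
  qed
  then obtain T xs where T: "0 < T" "\<And>t. xs t \<in> K"
    and cnt: "\<And>h. h \<in> \<F> \<Longrightarrow> q / 4 * real T \<le> real (card {t. t < T \<and> 2 * \<delta> * max \<epsilon> (f (xs t)) < \<bar>f (xs t) - h (xs t)\<bar>})"
    by blast
  have "q / 4 * real T \<le> real (card {t. t < T \<and> D g (xs t)})"
    if g: "convex_on K g" "euclid_lipschitz_on n 1 K g" "\<alpha> \<in> K" "g \<alpha> < - \<epsilon>" for g \<alpha>
  proof (cases "g \<in> \<G>")
    case True
    then obtain h where h: "h \<in> \<F>" "\<forall>x\<in>K. \<bar>g x - h x\<bar> \<le> 3 * \<sigma>" using F(3) by blast
    have "card {t. t < T \<and> 2 * \<delta> * max \<epsilon> (f (xs t)) < \<bar>f (xs t) - h (xs t)\<bar>} \<le> card {t. t < T \<and> D g (xs t)}"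
      using transfer[OF h(2) T(2)] by (intro card_mono) auto
    then show ?thesis using cnt[OF h(1)] by linarith
  next
    case False
    then have "g x < - (\<epsilon> / 2)" if "x \<in> K" for x
      using g that unfolding \<G>_def by (auto simp: not_le)
    then have "{t. t < T \<and> D g (xs t)} = {..<T}" using easy T(2) by auto
    then show ?thesis using mult_right_mono[OF q(2), of "real T"] by simp
  qed
  then show ?thesis using T unfolding D_def \<delta>_def q(3) by blast
qed

theorem theorem1:
  shows "\<exists>c::real. c > 0 \<and>
    (\<forall>(n::nat) (K :: (nat \<Rightarrow> real) set) (f :: (nat \<Rightarrow> real) \<Rightarrow> real) (\<epsilon>::real).
       n \<ge> 1 \<longrightarrow>
       convex_body n K \<longrightarrow> euclid_diameter n K \<le> 1 \<longrightarrow>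
       (\<forall>x\<in>K. 0 \<le> f x) \<longrightarrow> convex_on K f \<longrightarrow> euclid_lipschitz_on n 1 K f \<longrightarrow>
       0 < \<epsilon> \<longrightarrow> \<epsilon> \<le> real n \<longrightarrow>
       (\<exists>\<mu>. prob_measure_on K \<mu> \<and>
          (\<forall>\<alpha>\<in>K. \<forall>g :: (nat \<Rightarrow> real) \<Rightarrow> real.
             convex_on K g \<longrightarrow> euclid_lipschitz_on n 1 K g \<longrightarrow> g \<alpha> < - \<epsilon> \<longrightarrow>
             measure \<mu> {x \<in> K. \<bar>f x - g x\<bar> >
                 c / (real n powr 7.5 * ln (1 + real n / \<epsilon>)) * max \<epsilon> (f x)}
               > c / (real n ^ 3 * ln (1 + real n / \<epsilon>)))))"
proof -
  \<comment> \<open>Any value below \<open>1 / 3932160\<close> and strictly below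
    \<open>1 / 18432\<close> would do.\<close>
  define c :: real where "c = 1 / 10 ^ 7"
  have main: "\<exists>\<mu>. prob_measure_on K \<mu> \<and>
          (\<forall>\<alpha>\<in>K. \<forall>g :: (nat \<Rightarrow> real) \<Rightarrow> real.
             convex_on K g \<longrightarrow> euclid_lipschitz_on n 1 K g \<longrightarrow> g \<alpha> < - \<epsilon> \<longrightarrow>
             measure \<mu> {x \<in> K. \<bar>f x - g x\<bar> >
                 c / (real n powr 7.5 * ln (1 + real n / \<epsilon>)) * max \<epsilon> (f x)}
               > c / (real n ^ 3 * ln (1 + real n / \<epsilon>)))"
    if n: "n \<ge> 1" and K: "convex_body n K" "euclid_diameter n K \<le> 1"
      and f: "\<forall>x\<in>K. 0 \<le> f x" "convex_on K f" "euclid_lipschitz_on n 1 K f"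
      and e: "0 < \<epsilon>" "\<epsilon> \<le> real n"
    for n :: nat and K :: "(nat \<Rightarrow> real) set" and f :: "(nat \<Rightarrow> real) \<Rightarrow> real" and \<epsilon> :: real
  proof -
    define L where "L = ln (1 + real n / \<epsilon>)"
    define \<delta> where "\<delta> = c / (real n powr 7.5 * L)"
    have L0: "0 < L" unfolding L_def using n e by (intro ln_gt_zero) simp
    have n0: "0 < n" using n by simp
    have f0: "\<And>x. x \<in> K \<Longrightarrow> 0 \<le> f x" using f(1) by blast
    obtain T xs where T: "0 < T" "\<And>t. xs t \<in> K"
      and cnt: "\<And>\<alpha> g. \<alpha> \<in> K \<Longrightarrow> convex_on K g \<Longrightarrow> euclid_lipschitz_on n 1 K g \<Longrightarrow> g \<alpha> < - \<epsilon> \<Longrightarrow>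
        1 / (18432 * real n ^ 3 * L) * real T \<le>
        real (card {t. t < T \<and> \<bar>f (xs t) - g (xs t)\<bar> > 1 / (3932160 * real n ^ 3 * L) * max \<epsilon> (f (xs t))})"
      using exploration_points[OF n0 K f0 f(2,3) e L_def] by blast
    obtain \<mu> where mu: "prob_measure_on K \<mu>"
      and meas: "\<And>A. A \<in> sets (restrict_space borel K) \<Longrightarrow> measure \<mu> A = real (card {t. t < T \<and> xs t \<in> A}) / real T"
      using empirical_measure[OF T(1), of xs K] T(2) by blast
    \<comment> \<open>The detection obtained has the larger threshold with \<open>n ^ 3\<close>;
      this comparison weakens it to the one in the statement.\<close>
    have "real n ^ 3 \<le> real n powr 7.5"
      using n powr_mono[of 3 "7.5" "real n"] by (simp add: powr_realpow[of "real n" 3, simplified])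
    then have "\<delta> \<le> c / (real n ^ 3 * L)"
      unfolding \<delta>_def c_def using n L0 by (intro divide_left_mono mult_right_mono mult_pos_pos) auto
    also have "\<dots> \<le> 1 / (3932160 * real n ^ 3 * L)"
      unfolding c_def using n L0 by (simp add: field_simps)
    finally have \<delta>: "\<delta> \<le> 1 / (3932160 * real n ^ 3 * L)" .
    have "c / (real n ^ 3 * L) < measure \<mu> {x \<in> K. \<bar>f x - g x\<bar> > \<delta> * max \<epsilon> (f x)}"
      if g: "\<alpha> \<in> K" "convex_on K g" "euclid_lipschitz_on n 1 K g" "g \<alpha> < - \<epsilon>" for \<alpha> g
    proof -
      let ?M = "restrict_space borel K"
      let ?A = "{x \<in> K. \<bar>f x - g x\<bar> > \<delta> * max \<epsilon> (f x)}"
      \<comment> \<open>Lipschitz functions are continuous on \<open>K\<close>, so the detection set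
        is an event and the counting formula for \<open>\<mu>\<close> applies to it.\<close>
      have [measurable]: "f \<in> borel_measurable ?M" "g \<in> borel_measurable ?M"
        using f(3) g(3) by (auto intro!: borel_measurable_continuous_on_restrict euclid_lipschitz_continuous_on)
      have "{x \<in> space ?M. \<bar>f x - g x\<bar> > \<delta> * max \<epsilon> (f x)} \<in> sets ?M" by measurable
      then have A: "?A \<in> sets ?M" by (simp add: space_restrict_space)
      have "card {t. t < T \<and> \<bar>f (xs t) - g (xs t)\<bar> > 1 / (3932160 * real n ^ 3 * L) * max \<epsilon> (f (xs t))}
        \<le> card {t. t < T \<and> xs t \<in> ?A}"
      proof (rule card_mono)
        have "\<delta> * max \<epsilon> (f x) \<le> 1 / (3932160 * real n ^ 3 * L) * max \<epsilon> (f x)" for x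
          using \<delta> e by (intro mult_right_mono) auto
        then show "{t. t < T \<and> \<bar>f (xs t) - g (xs t)\<bar> > 1 / (3932160 * real n ^ 3 * L) * max \<epsilon> (f (xs t))}
          \<subseteq> {t. t < T \<and> xs t \<in> ?A}" using T(2) by (auto intro: le_less_trans)
      qed simp
      then have "1 / (18432 * real n ^ 3 * L) * real T \<le> real (card {t. t < T \<and> xs t \<in> ?A})"
        using cnt[OF g] by linarith
      then have "1 / (18432 * real n ^ 3 * L) \<le> measure \<mu> ?A"
        unfolding meas[OF A] using T(1) by (simp add: pos_le_divide_eq)
      moreover have "c / (real n ^ 3 * L) < 1 / (18432 * real n ^ 3 * L)"
        unfolding c_def using n L0 by (simp add: field_simps)
      ultimately show ?thesis by linarith
    qed
    then show ?thesis using mu unfolding \<delta>_def L_def by blast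
  qed
  have "c > 0" unfolding c_def by simp
  then show ?thesis using main by (intro exI[of _ c]) blast
qed

end
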